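(* Let $(X,\Sigma,\mathfrak m)$ be a probability space and $(\Omega,\mathcal A)$ a measurable space. Then the space $(\mathcal M(\Omega;L^0(\mathfrak m)),|\cdot|_{\rm TV})$ of all $L^0$-valued measures of bounded variation on $(\Omega,\mathcal A)$ is a complete random normed module with base $(X,\Sigma,\mathfrak m)$.
   Context: $L^0(\mathfrak m)$ is the algebra of $\mathfrak m$-a.e. equivalence classes of measurable functions $X\to\mathbb R$, with the $\mathfrak m$-a.e. order and the distance $d_{L^0(\mathfrak m)}(f,g)=\int|f-g|\wedge1\,\mathrm d\mathfrak m$; $L^0_+(\mathfrak m)$ is its positive cone; $\bar L^0(\mathfrak m)$ is the complete lattice of classes of $[-\infty,+\infty]$-valued measurable functions, in which suprema $\bigvee$ are taken. A sequence in $L^0_+(\mathfrak m)$ is summable if its partial sums are order bounded in $L^0(\mathfrak m)$; its sum is the supremum of the partial sums. A random normed module with base $(X,\Sigma,\mathfrak m)$ is a module $M$ over $L^0(\mathfrak m)$ with a map $|\cdot|\colon M\to L^0_+(\mathfrak m)$ such that $|v|=0$ iff $v=0$, $|v+w|\le|v|+|w|$ and $|f\cdot v|=|f||v|$ for all $v,w\in M$, $f\in L^0(\mathfrak m)$; it is complete if the distance $d_M(v,w)=\int|v-w|\wedge1\,\mathrm d\mathfrak m$ is complete. An $L^0$-valued measure is a map $\mu\colon\mathcal A\to L^0(\mathfrak m)$ with $\mu(\varnothing)=0$ such that for pairwise disjoint $(A_n)_{n\in\mathbb N}\subseteq\mathcal A$ the sequence $(|\mu(A_n)|)_n$ is summable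 and $\mu(\bigcup_nA_n)=\sum_n\mu(A_n)$ (limit in $L^0(\mathfrak m)$ of the partial sums). Its $L^0$-total variation is $|\mu|(A)=\bigvee\{\sum_n|\mu(A_n)|:(A_n)_{n\in\mathbb N}\subseteq\mathcal A\text{ partition of }A\}\in\bar L^0(\mathfrak m)$ for $A\in\mathcal A$; $\mu$ is of bounded variation if $|\mu|_{\rm TV}:=|\mu|(\Omega)\in L^0_+(\mathfrak m)$. The module operations on $\mathcal M(\Omega;L^0(\mathfrak m))$ are $(\mu+\nu)(A)=\mu(A)+\nu(A)$ and $(f\cdot\mu)(A)=f\,\mu(A)$. *)

theory Defs
  imports "HOL-Probability.Probability" "HOL-Algebra.Module" "HOL-Algebra.Complete_Lattice"
begin

section \<open>Classes of measurable functions\<close>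

type_synonym ('a, 'b) ae_class = "('a \<Rightarrow> 'b) set"

definition ae_rel :: "'a measure \<Rightarrow> (('a \<Rightarrow> 'b::topological_space) \<times> ('a \<Rightarrow> 'b)) set" where
  "ae_rel M = {(f, g). f \<in> borel_measurable M \<and> g \<in> borel_measurable M \<and> (AE x in M. f x = g x)}"

definition ae_classes :: "'a measure \<Rightarrow> ('a, 'b::topological_space) ae_class set" where
  "ae_classes M = borel_measurable M // ae_rel M"

definition cls :: "'a measure \<Rightarrow> ('a \<Rightarrow> 'b::topological_space) \<Rightarrow> ('a, 'b) ae_class" where
  "cls M f = ae_rel M `` {f}"

text \<open>
  All operations below act through representatives; they are invariant under changing the
  representative on a null set.
\<close>

definition rep :: "('a, 'b) ae_class \<Rightarrow> 'a \<Rightarrow> 'b" where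
  "rep u = (SOME f. f \<in> u)"

definition ae_le :: "'a measure \<Rightarrow> ('a, 'b::order) ae_class \<Rightarrow> ('a, 'b) ae_class \<Rightarrow> bool" where
  "ae_le M u v \<longleftrightarrow> (AE x in M. rep u x \<le> rep v x)"


section \<open>The algebra of real classes and the lattice of extended real classes\<close>

definition L0 :: "'a measure \<Rightarrow> ('a, real) ae_class ring" where
  "L0 M = \<lparr>carrier = ae_classes M,
           mult = (\<lambda>u v. cls M (\<lambda>x. rep u x * rep v x)),
           one = cls M (\<lambda>x. 1),
           zero = cls M (\<lambda>x. 0),
           add = (\<lambda>u v. cls M (\<lambda>x. rep u x + rep v x))\<rparr>"

definition L0_abs :: "'a measure \<Rightarrow> ('a, real) ae_class \<Rightarrow> ('a, real) ae_class" where
  "L0_abs M u = cls M (\<lambda>x. \<bar>rep u x\<bar>)"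

definition L0_pos :: "'a measure \<Rightarrow> ('a, real) ae_class set" where
  "L0_pos M = {u \<in> carrier (L0 M). ae_le M \<zero>\<^bsub>L0 M\<^esub> u}"

definition L0_dist :: "'a measure \<Rightarrow> ('a, real) ae_class \<Rightarrow> ('a, real) ae_class \<Rightarrow> real" where
  "L0_dist M u v = (\<integral>x. min \<bar>rep u x - rep v x\<bar> 1 \<partial>M)"

definition L0_bar :: "'a measure \<Rightarrow> ('a, ereal) ae_class gorder" where
  "L0_bar M = \<lparr>carrier = ae_classes M, eq = (=), le = ae_le M\<rparr>"

definition to_bar :: "'a measure \<Rightarrow> ('a, real) ae_class \<Rightarrow> ('a, ereal) ae_class" where
  "to_bar M u = cls M (\<lambda>x. ereal (rep u x))"

definition L0_summable :: "'a measure \<Rightarrow> (nat \<Rightarrow> ('a, real) ae_class) \<Rightarrow> bool" where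
  "L0_summable M u \<longleftrightarrow>
     (\<forall>n. u n \<in> L0_pos M) \<and>
     (\<exists>b\<in>carrier (L0 M). \<forall>N. ae_le M (\<Oplus>\<^bsub>L0 M\<^esub>n\<in>{..<N}. u n) b)"

definition L0_suminf :: "'a measure \<Rightarrow> (nat \<Rightarrow> ('a, real) ae_class) \<Rightarrow> ('a, ereal) ae_class" where
  "L0_suminf M u = \<Squnion>\<^bsub>L0_bar M\<^esub> (range (\<lambda>N. to_bar M (\<Oplus>\<^bsub>L0 M\<^esub>n\<in>{..<N}. u n)))"


section \<open>Random normed modules\<close>

text \<open>
  The distance is set to zero off the carrier, since \<^locale>\<open>Metric_space\<close> requires
  nonnegativity and symmetry on the whole type.
\<close>

definition rn_dist ::
  "'a measure \<Rightarrow> (('a, real) ae_class, 'v, 'z) module_scheme \<Rightarrow> ('v \<Rightarrow> ('a, real) ae_class)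
     \<Rightarrow> 'v \<Rightarrow> 'v \<Rightarrow> real" where
  "rn_dist M V nrm v w =
     (if v \<in> carrier V \<and> w \<in> carrier V
      then \<integral>x. min (rep (nrm (v \<ominus>\<^bsub>V\<^esub> w)) x) 1 \<partial>M else 0)"

locale random_normed_module =
  prob_space M + Module.module "L0 M" V
  for M :: "'a measure"
    and V :: "(('a, real) ae_class, 'v, 'z) module_scheme"
    and nrm :: "'v \<Rightarrow> ('a, real) ae_class" +
  assumes nrm_pos: "v \<in> carrier V \<Longrightarrow> nrm v \<in> L0_pos M"
    and nrm_eq_zero_iff: "v \<in> carrier V \<Longrightarrow> nrm v = \<zero>\<^bsub>L0 M\<^esub> \<longleftrightarrow> v = \<zero>\<^bsub>V\<^esub>"
    and nrm_triangle:
      "\<lbrakk>v \<in> carrier V; w \<in> carrier V\<rbrakk> \<Longrightarrow> ae_le M (nrm (v \<oplus>\<^bsub>V\<^esub> w)) (nrm v \<oplus>\<^bsub>L0 M\<^esub> nrm w)"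
    and nrm_smult:
      "\<lbrakk>f \<in> carrier (L0 M); v \<in> carrier V\<rbrakk> \<Longrightarrow> nrm (f \<odot>\<^bsub>V\<^esub> v) = L0_abs M f \<otimes>\<^bsub>L0 M\<^esub> nrm v"

locale complete_random_normed_module =
  random_normed_module M V nrm
  for M :: "'a measure"
    and V :: "(('a, real) ae_class, 'v, 'z) module_scheme"
    and nrm :: "'v \<Rightarrow> ('a, real) ae_class" +
  assumes metric: "Metric_space (carrier V) (rn_dist M V nrm)"
    and complete: "Metric_space.mcomplete (carrier V) (rn_dist M V nrm)"


section \<open>Measures with values in the algebra of real classes\<close>

text \<open>
  Such measures are extensional, i.e. \<^const>\<open>undefined\<close> outside the sigma-algebra, so that
  equality of measures is equality on the sigma-algebra.
\<close>

definition L0_measure ::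
  "'a measure \<Rightarrow> 'o set set \<Rightarrow> ('o set \<Rightarrow> ('a, real) ae_class) \<Rightarrow> bool" where
  "L0_measure M \<A> \<mu> \<longleftrightarrow>
     \<mu> \<in> \<A> \<rightarrow>\<^sub>E carrier (L0 M) \<and>
     \<mu> {} = \<zero>\<^bsub>L0 M\<^esub> \<and>
     (\<forall>A :: nat \<Rightarrow> 'o set. range A \<subseteq> \<A> \<longrightarrow> disjoint_family A \<longrightarrow>
        L0_summable M (\<lambda>n. L0_abs M (\<mu> (A n))) \<and>
        limitin (Metric_space.mtopology (carrier (L0 M)) (L0_dist M))
          (\<lambda>N. \<Oplus>\<^bsub>L0 M\<^esub>n\<in>{..<N}. \<mu> (A n)) (\<mu> (\<Union>n. A n)) sequentially)"

definition L0_variation ::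
  "'a measure \<Rightarrow> 'o set set \<Rightarrow> ('o set \<Rightarrow> ('a, real) ae_class) \<Rightarrow> 'o set \<Rightarrow> ('a, ereal) ae_class" where
  "L0_variation M \<A> \<mu> A =
     \<Squnion>\<^bsub>L0_bar M\<^esub> {L0_suminf M (\<lambda>n. L0_abs M (\<mu> (P n))) | P :: nat \<Rightarrow> 'o set.
       range P \<subseteq> \<A> \<and> disjoint_family P \<and> (\<Union>n. P n) = A}"

definition bounded_variation ::
  "'a measure \<Rightarrow> 'o set \<Rightarrow> 'o set set \<Rightarrow> ('o set \<Rightarrow> ('a, real) ae_class) \<Rightarrow> bool" where
  "bounded_variation M \<Omega> \<A> \<mu> \<longleftrightarrow> L0_variation M \<A> \<mu> \<Omega> \<in> to_bar M ` L0_pos M"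

definition TV_norm ::
  "'a measure \<Rightarrow> 'o set \<Rightarrow> 'o set set \<Rightarrow> ('o set \<Rightarrow> ('a, real) ae_class) \<Rightarrow> ('a, real) ae_class" where
  "TV_norm M \<Omega> \<A> \<mu> = the_inv_into (carrier (L0 M)) (to_bar M) (L0_variation M \<A> \<mu> \<Omega>)"

text \<open>The fields \<^const>\<open>mult\<close> and \<^const>\<open>one\<close> of a module record play no role.\<close>

definition L0_measures ::
  "'a measure \<Rightarrow> 'o set \<Rightarrow> 'o set set
     \<Rightarrow> (('a, real) ae_class, 'o set \<Rightarrow> ('a, real) ae_class) module" where
  "L0_measures M \<Omega> \<A> =
     \<lparr>carrier = {\<mu>. L0_measure M \<A> \<mu> \<and> bounded_variation M \<Omega> \<A> \<mu>},
      mult = undefined,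
      one = undefined,
      zero = (\<lambda>A\<in>\<A>. \<zero>\<^bsub>L0 M\<^esub>),
      add = (\<lambda>\<mu> \<nu>. \<lambda>A\<in>\<A>. \<mu> A \<oplus>\<^bsub>L0 M\<^esub> \<nu> A),
      smult = (\<lambda>f \<mu>. \<lambda>A\<in>\<A>. f \<otimes>\<^bsub>L0 M\<^esub> \<mu> A)\<rparr>"

end

theory Submission
  imports Defs
begin

text \<open>
  Through representatives, the total variation of a measure is the least measurable \<open>g\<close> with
  \<open>\<Sum>n<N. \<bar>\<mu> (P n)\<bar> \<le> g\<close> almost everywhere for every countable partition \<open>P\<close> and every \<open>N\<close>;
  it exists because arbitrary families of classes have essential suprema. The norm axioms follow
  from this minimality. For completeness, a Cauchy sequence has a subsequence \<open>v\<close> whose increments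
  have almost everywhere summable total variations, with tails \<open>G k\<close> tending to 0. On each set the
  values \<open>v k A\<close> then converge almost everywhere to some \<open>w A\<close>, and
  \<open>\<Sum>n<N. \<bar>v k (P n) - w (P n)\<bar> \<le> G k\<close> for every disjoint sequence \<open>P\<close>. This uniform bound gives
  the countable additivity of \<open>w\<close>, its bounded variation and the convergence in total variation.
\<close>

section \<open>Almost everywhere classes\<close>

text \<open>Almost everywhere statements combine only over countably many indices, whereas
  \<open>\<A>\<close> and the set of partitions of \<Omega> are in general uncountable. Each
  estimate therefore fixes one disjoint sequence, whose countably many members and partial sums
  share a null set, and the limit measure is formed set by set with an exceptional set depending on
  the set. A second obstacle is that countable additivity is stated in the metric of
  \<open>L0 M\<close>, where convergence does not imply almost everywhere convergence. A finite
  variation bound removes it: the series then converge absolutely almost everywhere, and for such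
  series the metric sum and the almost everywhere sum coincide. From then on only real series at
  fixed points occur.\<close>

lemma equiv_ae_rel: "equiv (borel_measurable M) (ae_rel M)"
proof (rule equivI)
  show "ae_rel M \<subseteq> borel_measurable M \<times> borel_measurable M"
    by (auto simp: ae_rel_def)
  show "refl_on (borel_measurable M) (ae_rel M)"
    by (auto simp: refl_on_def ae_rel_def)
  show "sym (ae_rel M)"
    by (auto simp: sym_def ae_rel_def eq_commute)
  show "trans (ae_rel M)"
  proof (rule transI)
    fix f g h
    assume "(f, g) \<in> ae_rel M" "(g, h) \<in> ae_rel M"
    then show "(f, h) \<in> ae_rel M"
      unfolding ae_rel_def by (auto elim: AE_mp)
  qed
qed

lemma cls_in_ae_classes [intro]: "f \<in> borel_measurable M \<Longrightarrow> cls M f \<in> ae_classes M"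
  by (auto simp: cls_def ae_classes_def quotient_def)

lemma rep_in:
  assumes "u \<in> ae_classes M"
  shows "rep u \<in> u"
proof -
  have "u \<noteq> {}"
    using assms in_quotient_imp_non_empty[OF equiv_ae_rel] by (auto simp: ae_classes_def)
  then show ?thesis
    unfolding rep_def by (simp add: some_in_eq)
qed

lemma rep_measurable [measurable (raw)]:
  assumes "u \<in> ae_classes M"
  shows "rep u \<in> borel_measurable M"
  using rep_in[OF assms] in_quotient_imp_subset[OF equiv_ae_rel assms[unfolded ae_classes_def]]
  by auto

lemma rep_cls:
  assumes "f \<in> borel_measurable M"
  shows "AE x in M. rep (cls M f) x = f x"
  using rep_in[OF cls_in_ae_classes[OF assms]]
  by (auto simp: cls_def ae_rel_def eq_commute)

lemma cls_eqI:
  assumes "f \<in> borel_measurable M" "g \<in> borel_measurable M" "AE x in M. f x = g x"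
  shows "cls M f = cls M g"
  unfolding cls_def using assms
  by (intro equiv_class_eq[OF equiv_ae_rel]) (auto simp: ae_rel_def)

lemma cls_rep:
  assumes "u \<in> ae_classes M"
  shows "cls M (rep u) = u"
proof -
  obtain f where f: "f \<in> borel_measurable M" "u = cls M f"
    using assms by (auto simp: ae_classes_def quotient_def cls_def)
  show ?thesis
    using rep_cls[OF f(1)] rep_measurable[OF assms] f by (metis cls_eqI)
qed

lemma ae_class_eqI:
  assumes "u \<in> ae_classes M" "v \<in> ae_classes M" "AE x in M. rep u x = rep v x"
  shows "u = v"
  using assms by (metis cls_eqI cls_rep rep_measurable)

section \<open>The ring of real classes\<close>

lemma carrier_L0 [simp]: "carrier (L0 M) = ae_classes M"
  by (simp add: L0_def)

lemma L0_closed [simp, intro]: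
  "\<zero>\<^bsub>L0 M\<^esub> \<in> ae_classes M" "\<one>\<^bsub>L0 M\<^esub> \<in> ae_classes M"
  "\<lbrakk>u \<in> ae_classes M; v \<in> ae_classes M\<rbrakk> \<Longrightarrow> u \<oplus>\<^bsub>L0 M\<^esub> v \<in> ae_classes M"
  "\<lbrakk>u \<in> ae_classes M; v \<in> ae_classes M\<rbrakk> \<Longrightarrow> u \<otimes>\<^bsub>L0 M\<^esub> v \<in> ae_classes M"
  "u \<in> ae_classes M \<Longrightarrow> L0_abs M u \<in> ae_classes M"
  by (auto simp: L0_def L0_abs_def)

lemma rep_zero: "AE x in M. rep \<zero>\<^bsub>L0 M\<^esub> x = 0"
  and rep_one: "AE x in M. rep \<one>\<^bsub>L0 M\<^esub> x = 1"
  by (auto simp: L0_def intro: rep_cls)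

lemma rep_add:
  assumes [simp]: "u \<in> ae_classes M" "v \<in> ae_classes M"
  shows "AE x in M. rep (u \<oplus>\<^bsub>L0 M\<^esub> v) x = rep u x + rep v x"
  by (auto simp: L0_def intro!: rep_cls)

lemma rep_mult:
  assumes [simp]: "u \<in> ae_classes M" "v \<in> ae_classes M"
  shows "AE x in M. rep (u \<otimes>\<^bsub>L0 M\<^esub> v) x = rep u x * rep v x"
  by (auto simp: L0_def intro!: rep_cls)

lemma rep_abs:
  assumes [simp]: "u \<in> ae_classes M"
  shows "AE x in M. rep (L0_abs M u) x = \<bar>rep u x\<bar>"
  by (auto simp: L0_abs_def intro!: rep_cls)

text \<open>The representative of a sum or product agrees with the pointwise operation only almost
  everywhere. Each law that mixes operations thus collects the finitely many exceptional sets
  involved and uses the corresponding law of the reals outside them.\<close>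

lemma cring_L0: "cring (L0 M)"
proof (rule cringI)
  show "abelian_group (L0 M)"
  proof (rule abelian_groupI; unfold carrier_L0)
    fix u v w :: "('a, real) ae_class"
    assume [simp]: "u \<in> ae_classes M" "v \<in> ae_classes M" "w \<in> ae_classes M"
    show "u \<oplus>\<^bsub>L0 M\<^esub> v \<oplus>\<^bsub>L0 M\<^esub> w = u \<oplus>\<^bsub>L0 M\<^esub> (v \<oplus>\<^bsub>L0 M\<^esub> w)"
      using rep_add[of u M v] rep_add[of "u \<oplus>\<^bsub>L0 M\<^esub> v" M w] rep_add[of v M w]
        rep_add[of u M "v \<oplus>\<^bsub>L0 M\<^esub> w"]
      by (intro ae_class_eqI[of _ M]) (auto elim!: eventually_elim2)
    show "u \<oplus>\<^bsub>L0 M\<^esub> v = v \<oplus>\<^bsub>L0 M\<^esub> u"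
      by (simp add: L0_def add.commute)
    show "\<zero>\<^bsub>L0 M\<^esub> \<oplus>\<^bsub>L0 M\<^esub> u = u"
      using rep_add[of "\<zero>\<^bsub>L0 M\<^esub>" M u] rep_zero[of M]
      by (intro ae_class_eqI[of _ M]) (auto elim!: eventually_elim2)
    have [measurable]: "rep u \<in> borel_measurable M" by (rule rep_measurable) simp
    have [simp]: "cls M (\<lambda>x. - rep u x) \<in> ae_classes M" by auto
    have "cls M (\<lambda>x. - rep u x) \<oplus>\<^bsub>L0 M\<^esub> u = \<zero>\<^bsub>L0 M\<^esub>"
      using rep_add[of "cls M (\<lambda>x. - rep u x)" M u] rep_zero[of M] rep_cls[of "\<lambda>x. - rep u x" M]
      by (intro ae_class_eqI[of _ M]) (auto elim!: eventually_elim2)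
    then show "\<exists>y\<in>ae_classes M. y \<oplus>\<^bsub>L0 M\<^esub> u = \<zero>\<^bsub>L0 M\<^esub>"
      by (rule bexI) auto
  qed auto
  show "comm_monoid (L0 M)"
  proof (rule comm_monoidI; unfold carrier_L0)
    fix u v w :: "('a, real) ae_class"
    assume [simp]: "u \<in> ae_classes M" "v \<in> ae_classes M" "w \<in> ae_classes M"
    show "u \<otimes>\<^bsub>L0 M\<^esub> v \<otimes>\<^bsub>L0 M\<^esub> w = u \<otimes>\<^bsub>L0 M\<^esub> (v \<otimes>\<^bsub>L0 M\<^esub> w)"
      using rep_mult[of u M v] rep_mult[of "u \<otimes>\<^bsub>L0 M\<^esub> v" M w] rep_mult[of v M w]
        rep_mult[of u M "v \<otimes>\<^bsub>L0 M\<^esub> w"]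
      by (intro ae_class_eqI[of _ M]) (auto elim!: eventually_elim2)
    show "u \<otimes>\<^bsub>L0 M\<^esub> v = v \<otimes>\<^bsub>L0 M\<^esub> u"
      by (simp add: L0_def mult.commute)
    show "\<one>\<^bsub>L0 M\<^esub> \<otimes>\<^bsub>L0 M\<^esub> u = u"
      using rep_mult[of "\<one>\<^bsub>L0 M\<^esub>" M u] rep_one[of M]
      by (intro ae_class_eqI[of _ M]) (auto elim!: eventually_elim2)
  qed auto
  fix u v w :: "('a, real) ae_class"
  assume "u \<in> carrier (L0 M)" "v \<in> carrier (L0 M)" "w \<in> carrier (L0 M)"
  then have [simp]: "u \<in> ae_classes M" "v \<in> ae_classes M" "w \<in> ae_classes M"
    by auto
  show "(u \<oplus>\<^bsub>L0 M\<^esub> v) \<otimes>\<^bsub>L0 M\<^esub> w = u \<otimes>\<^bsub>L0 M\<^esub> w \<oplus>\<^bsub>L0 M\<^esub> v \<otimes>\<^bsub>L0 M\<^esub> w"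
    using rep_mult[of "u \<oplus>\<^bsub>L0 M\<^esub> v" M w] rep_mult[of u M w] rep_mult[of v M w]
      rep_add[of u M v] rep_add[of "u \<otimes>\<^bsub>L0 M\<^esub> w" M "v \<otimes>\<^bsub>L0 M\<^esub> w"]
    by (intro ae_class_eqI[of _ M]) (auto elim!: eventually_elim2 simp: algebra_simps)
qed

text \<open>Negation in \<open>L0 M\<close> is the abstract group inverse and has no defining
  formula, so its representative is read off from the equation that characterises inverses.\<close>

lemma rep_a_inv:
  assumes u: "u \<in> ae_classes M"
  shows "AE x in M. rep (\<ominus>\<^bsub>L0 M\<^esub> u) x = - rep u x"
proof -
  interpret R: cring "L0 M" by (rule cring_L0)
  have *: "\<ominus>\<^bsub>L0 M\<^esub> u \<in> ae_classes M"
    using R.a_inv_closed[of u] u by simp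
  have "\<ominus>\<^bsub>L0 M\<^esub> u \<oplus>\<^bsub>L0 M\<^esub> u = \<zero>\<^bsub>L0 M\<^esub>"
    using R.l_neg[of u] u by simp
  then have "AE x in M. rep \<zero>\<^bsub>L0 M\<^esub> x = rep (\<ominus>\<^bsub>L0 M\<^esub> u) x + rep u x"
    using rep_add[OF * u] by simp
  with rep_zero[of M] show ?thesis
    by eventually_elim simp
qed

lemma rep_finsum:
  assumes "finite I" "\<And>i. i \<in> I \<Longrightarrow> u i \<in> ae_classes M"
  shows "AE x in M. rep (\<Oplus>\<^bsub>L0 M\<^esub>i\<in>I. u i) x = (\<Sum>i\<in>I. rep (u i) x)"
  using assms
proof (induction I)
  case empty
  interpret cring "L0 M" by (rule cring_L0)
  show ?case by (simp add: rep_zero)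
next
  case (insert i I)
  interpret cring "L0 M" by (rule cring_L0)
  have "(\<Oplus>\<^bsub>L0 M\<^esub>i\<in>I. u i) \<in> ae_classes M"
    using finsum_closed[of u I] insert.prems by auto
  moreover have "(\<Oplus>\<^bsub>L0 M\<^esub>i\<in>insert i I. u i) = u i \<oplus>\<^bsub>L0 M\<^esub> (\<Oplus>\<^bsub>L0 M\<^esub>i\<in>I. u i)"
    using insert by (intro finsum_insert) auto
  ultimately show ?case
    using rep_add[of "u i" M "\<Oplus>\<^bsub>L0 M\<^esub>i\<in>I. u i"] insert.IH insert.prems insert.hyps
    by (auto elim!: eventually_elim2)
qed

lemma finsum_L0_closed [intro]:
  assumes "\<And>i. i \<in> I \<Longrightarrow> u i \<in> ae_classes M"
  shows "(\<Oplus>\<^bsub>L0 M\<^esub>i\<in>I. u i) \<in> ae_classes M"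
proof -
  interpret cring "L0 M" by (rule cring_L0)
  show ?thesis using finsum_closed[of u I] assms by auto
qed

lemma L0_pos_iff: "u \<in> L0_pos M \<longleftrightarrow> u \<in> ae_classes M \<and> (AE x in M. 0 \<le> rep u x)"
  using rep_zero[of M] by (auto simp: L0_pos_def ae_le_def elim: eventually_elim2)

section \<open>Essential suprema\<close>

text \<open>Among the countable subfamilies one maximises the integral of the bounded transform
  \<phi> of the supremum. The union of a maximising sequence is again countable and attains the
  maximum, so adding any member of \<open>F\<close> changes the supremum only on a null set.
  Leastness holds because countably many almost everywhere bounds share a null set.\<close>

lemma (in finite_measure) ess_sup_exists:
  fixes F :: "('a \<Rightarrow> ereal) set"
  assumes F: "F \<subseteq> borel_measurable M"
  shows "\<exists>s\<in>borel_measurable M. (\<forall>f\<in>F. AE x in M. f x \<le> s x) \<and>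
    (\<forall>t. (\<forall>f\<in>F. AE x in M. f x \<le> t x) \<longrightarrow> (AE x in M. s x \<le> t x))"
proof -
  \<comment> \<open>A bounded, strictly increasing map into the reals: boundedness makes all
    integrals finite, strictness lets equal integrals detect equal suprema. The values 2 and -2 lie
    beyond the range of \<open>arctan\<close>, since pi/2 < 2, so the infinite values keep their
    place in the order.\<close>
  define \<phi> :: "ereal \<Rightarrow> real" where
    "\<phi> y = (if y = \<infinity> then 2 else if y = - \<infinity> then - 2 else arctan (real_of_ereal y))" for y
  have arctan: "\<bar>arctan r\<bar> < 2" for r
    using arctan_bounded[of r] pi_less_4 by auto
  have \<phi>_bound: "\<bar>\<phi> y\<bar> \<le> 2" for y
    using arctan by (auto simp: \<phi>_def intro: less_imp_le)
  have \<phi>_mono: "\<phi> y < \<phi> z" if "y < z" for y z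
    using that arctan by (cases y; cases z) (auto simp: \<phi>_def arctan_less_iff abs_less_iff
      intro: order_less_trans[of _ "-2" 2] simp: minus_less_iff)
  have [measurable]: "\<phi> \<in> borel_measurable borel"
    unfolding \<phi>_def by measurable
  define S where "S C x = (SUP f\<in>C. f x)" for C :: "('a \<Rightarrow> ereal) set" and x
  define I where "I C = (\<integral>x. \<phi> (S C x) \<partial>M)" for C
  define \<C> where "\<C> = {C. countable C \<and> C \<subseteq> F}"
  have S_meas: "S C \<in> borel_measurable M" if "C \<in> \<C>" for C
    using that F unfolding S_def \<C>_def by (auto intro!: borel_measurable_SUP)
  have \<phi>S_int: "integrable M (\<lambda>x. \<phi> (S C x))" if "C \<in> \<C>" for C
    using S_meas[OF that] \<phi>_bound by (intro integrable_const_bound[where B = 2]) auto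
  have S_mono: "S C x \<le> S D x" if "C \<subseteq> D" for C D x
    unfolding S_def using that by (rule SUP_subset_mono) auto
  have \<phi>_mono': "\<phi> y \<le> \<phi> z" if "y \<le> z" for y z
    using \<phi>_mono[of y z] that by (cases "y = z") (auto simp: order_le_less)
  have I_mono: "I C \<le> I D" if "C \<subseteq> D" "C \<in> \<C>" "D \<in> \<C>" for C D
    unfolding I_def using that by (intro integral_mono \<phi>S_int \<phi>_mono' S_mono) auto
  have I_bound: "I C \<le> 2 * measure M (space M)" if "C \<in> \<C>" for C
    using integral_mono[OF \<phi>S_int[OF that] integrable_const[of 2]] \<phi>_bound
    by (auto simp: I_def abs_le_iff mult.commute)
  have "{} \<in> \<C>" by (auto simp: \<C>_def)
  have bdd: "bdd_above (I ` \<C>)"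
    using I_bound by (auto simp: bdd_above_def)
  have "\<exists>C\<in>\<C>. (SUP C\<in>\<C>. I C) - 1 / Suc n < I C" for n
    using \<open>{} \<in> \<C>\<close> by (subst less_cSUP_iff[OF _ bdd, symmetric]) auto
  then obtain C where C: "\<And>n. C n \<in> \<C>" "\<And>n. (SUP C\<in>\<C>. I C) - 1 / Suc n < I (C n)"
    by metis
  define D where "D = (\<Union>n. C n)"
  have "D \<in> \<C>"
    using C(1) by (auto simp: D_def \<C>_def)
  have "(SUP C\<in>\<C>. I C) \<le> I D"
  proof (rule LIMSEQ_le_const2)
    show "(\<lambda>n. (SUP C\<in>\<C>. I C) - 1 / Suc n) \<longlonglongrightarrow> (SUP C\<in>\<C>. I C)"
      using tendsto_diff[OF tendsto_const LIMSEQ_inverse_real_of_nat]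
      by (simp add: inverse_eq_divide)
    have "I (C n) \<le> I D" for n
      by (rule I_mono) (use C(1) \<open>D \<in> \<C>\<close> in \<open>auto simp: D_def\<close>)
    then show "\<exists>N. \<forall>n\<ge>N. (SUP C\<in>\<C>. I C) - 1 / Suc n \<le> I D"
      using C(2) by (meson less_eq_real_def order_trans)
  qed
  then have max: "I C \<le> I D" if "C \<in> \<C>" for C
    using cSUP_upper[OF that bdd] by simp
  show ?thesis
  proof (intro bexI[of _ "S D"] conjI ballI allI impI)
    show "S D \<in> borel_measurable M"
      using \<open>D \<in> \<C>\<close> by (rule S_meas)
    show "AE x in M. f x \<le> S D x" if "f \<in> F" for f
    proof -
      have E: "insert f D \<in> \<C>"
        using \<open>D \<in> \<C>\<close> that by (auto simp: \<C>_def)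
      have le: "\<phi> (S D x) \<le> \<phi> (S (insert f D) x)" for x
        by (intro \<phi>_mono' S_mono) auto
      have "I (insert f D) = I D"
        using max[OF E] I_mono[OF subset_insertI \<open>D \<in> \<C>\<close> E] by (rule order_antisym)
      then have "(\<integral>x. \<phi> (S (insert f D) x) - \<phi> (S D x) \<partial>M) = 0"
        using \<phi>S_int[OF E] \<phi>S_int[OF \<open>D \<in> \<C>\<close>] by (simp add: I_def)
      then have "AE x in M. \<phi> (S (insert f D) x) - \<phi> (S D x) = 0"
        using \<phi>S_int[OF E] \<phi>S_int[OF \<open>D \<in> \<C>\<close>] le
        by (subst (asm) integral_nonneg_eq_0_iff_AE) auto
      then show ?thesis
      proof eventually_elim
        case (elim x)
        then have "\<not> S D x < S (insert f D) x"
          using \<phi>_mono by fastforce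
        moreover have "f x \<le> S (insert f D) x"
          unfolding S_def by (rule SUP_upper) simp
        ultimately show ?case by auto
      qed
    qed
    show "AE x in M. S D x \<le> t x" if "\<forall>f\<in>F. AE x in M. f x \<le> t x" for t
    proof -
      have "AE x in M. \<forall>f\<in>D. f x \<le> t x"
        using that \<open>D \<in> \<C>\<close> by (subst AE_ball_countable) (auto simp: \<C>_def)
      then show ?thesis
        by eventually_elim (auto simp: S_def intro: SUP_least)
    qed
  qed
qed

section \<open>Suprema in the lattice of extended real classes\<close>

lemma carrier_L0_bar [simp]: "carrier (L0_bar M) = ae_classes M"
  by (simp add: L0_bar_def)

lemma le_L0_bar [simp]: "u \<sqsubseteq>\<^bsub>L0_bar M\<^esub> v \<longleftrightarrow> ae_le M u v"
  by (simp add: L0_bar_def)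

lemma ae_le_trans:
  assumes "ae_le M u v" "ae_le M v w"
  shows "ae_le M u w"
  using assms unfolding ae_le_def by eventually_elim (rule order_trans)

context finite_measure
begin

text \<open>The lattice supremum is a chosen least upper bound, so exhibiting one suffices: the
  class of the essential supremum of the representatives.\<close>

lemma Sup_L0_bar_least:
  assumes S: "S \<subseteq> ae_classes M"
  shows "least (L0_bar M) (\<Squnion>\<^bsub>L0_bar M\<^esub> S) (Upper (L0_bar M) S)"
proof -
  have "rep ` S \<subseteq> borel_measurable M"
    using S rep_measurable by auto
  from ess_sup_exists[OF this] obtain s where s: "s \<in> borel_measurable M"
      and upper: "\<forall>f\<in>rep ` S. AE x in M. f x \<le> s x"
      and least: "\<forall>t. (\<forall>f\<in>rep ` S. AE x in M. f x \<le> t x) \<longrightarrow> (AE x in M. s x \<le> t x)"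
    by blast
  have "ae_le M u (cls M s)" if "u \<in> S" for u
  proof -
    have "AE x in M. rep u x \<le> s x"
      using bspec[OF upper imageI[OF that]] .
    with rep_cls[OF s] show ?thesis
      unfolding ae_le_def by eventually_elim simp
  qed
  moreover have "ae_le M (cls M s) v" if "\<forall>u. u \<in> S \<longrightarrow> ae_le M u v" for v
  proof -
    have "AE x in M. s x \<le> rep v x"
      using spec[OF least, of "rep v"] that by (simp add: ae_le_def)
    with rep_cls[OF s] show ?thesis
      unfolding ae_le_def by eventually_elim simp
  qed
  ultimately have "least (L0_bar M) (cls M s) (Upper (L0_bar M) S)"
    using s S cls_in_ae_classes[OF s] by (auto simp: least_def Upper_def)
  then show ?thesis
    unfolding Lattice.sup_def by (rule someI)
qed

lemma Sup_L0_bar_closed: "S \<subseteq> ae_classes M \<Longrightarrow> \<Squnion>\<^bsub>L0_bar M\<^esub> S \<in> ae_classes M"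
  using Sup_L0_bar_least[of S] by (auto simp: least_def Upper_def)

text \<open>The universal property in the form in which suprema are used below: infinite sums and
  variations are never evaluated, only compared with upper bounds.\<close>

lemma Sup_L0_bar_le_iff:
  assumes S: "S \<subseteq> ae_classes M" and v: "v \<in> ae_classes M"
  shows "ae_le M (\<Squnion>\<^bsub>L0_bar M\<^esub> S) v \<longleftrightarrow> (\<forall>u\<in>S. ae_le M u v)"
proof
  assume "ae_le M (\<Squnion>\<^bsub>L0_bar M\<^esub> S) v"
  moreover have "ae_le M u (\<Squnion>\<^bsub>L0_bar M\<^esub> S)" if "u \<in> S" for u
    using Sup_L0_bar_least[OF S] S that by (auto simp: least_def Upper_def)
  ultimately show "\<forall>u\<in>S. ae_le M u v"
    using ae_le_trans by blast
next
  assume "\<forall>u\<in>S. ae_le M u v"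
  then have "v \<in> Upper (L0_bar M) S"
    using v by (auto simp: Upper_def)
  then show "ae_le M (\<Squnion>\<^bsub>L0_bar M\<^esub> S) v"
    using Sup_L0_bar_least[OF S] by (auto simp: least_def)
qed

end

lemma to_bar_closed [simp, intro]: "u \<in> ae_classes M \<Longrightarrow> to_bar M u \<in> ae_classes M"
  by (auto simp: to_bar_def)

lemma rep_to_bar: "u \<in> ae_classes M \<Longrightarrow> AE x in M. rep (to_bar M u) x = ereal (rep u x)"
  unfolding to_bar_def by (auto intro!: rep_cls)

text \<open>This makes the inverse in the definition of \<open>TV_norm\<close> meaningful: a
  variation that comes from a real class comes from exactly one.\<close>

lemma inj_on_to_bar: "inj_on (to_bar M) (ae_classes M)"
proof (rule inj_onI)
  fix u v assume *: "u \<in> ae_classes M" "v \<in> ae_classes M" "to_bar M u = to_bar M v"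
  have "AE x in M. rep u x = rep v x"
    using rep_to_bar[OF *(1)] rep_to_bar[OF *(2)] unfolding *(3) by eventually_elim auto
  then show "u = v"
    by (rule ae_class_eqI[OF *(1,2)])
qed

context finite_measure
begin

lemma L0_suminf_closed:
  assumes "\<And>n. u n \<in> ae_classes M"
  shows "L0_suminf M u \<in> ae_classes M"
  unfolding L0_suminf_def using assms by (intro Sup_L0_bar_closed) auto

lemma L0_suminf_le_iff:
  assumes u: "\<And>n. u n \<in> ae_classes M" and v: "v \<in> ae_classes M"
  shows "ae_le M (L0_suminf M u) v \<longleftrightarrow> (\<forall>N. AE x in M. ereal (\<Sum>n<N. rep (u n) x) \<le> rep v x)"
proof -
  have "ae_le M (to_bar M (\<Oplus>\<^bsub>L0 M\<^esub>n\<in>{..<N}. u n)) v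
      \<longleftrightarrow> (AE x in M. ereal (\<Sum>n<N. rep (u n) x) \<le> rep v x)" for N
  proof -
    have "AE x in M. rep (to_bar M (\<Oplus>\<^bsub>L0 M\<^esub>n\<in>{..<N}. u n)) x = ereal (\<Sum>n<N. rep (u n) x)"
      using rep_to_bar[OF finsum_L0_closed[of "{..<N}" u M, OF u]] rep_finsum[of "{..<N}" u M, OF finite_lessThan u]
      by eventually_elim auto
    then show ?thesis
      unfolding ae_le_def by (intro eventually_cong) auto
  qed
  then show ?thesis
    unfolding L0_suminf_def using u v by (subst Sup_L0_bar_le_iff) auto
qed

end

section \<open>Variation\<close>

definition partitions :: "'o set \<Rightarrow> 'o set set \<Rightarrow> (nat \<Rightarrow> 'o set) set" where
  "partitions \<Omega> \<A> = {P. range P \<subseteq> \<A> \<and> disjoint_family P \<and> (\<Union>n. P n) = \<Omega>}"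

text \<open>The exceptional null set may depend on \<open>P\<close> and \<open>N\<close>; it cannot
  be moved outside the quantifier over partitions. The bound is a function rather than a class, so
  that concrete expressions such as sums, quotients and tails of series can serve as bounds.\<close>

definition variation_le ::
  "'a measure \<Rightarrow> 'o set \<Rightarrow> 'o set set \<Rightarrow> ('o set \<Rightarrow> ('a, real) ae_class) \<Rightarrow> ('a \<Rightarrow> real) \<Rightarrow> bool"
where
  "variation_le M \<Omega> \<A> \<mu> g \<longleftrightarrow>
     (\<forall>P\<in>partitions \<Omega> \<A>. \<forall>N. AE x in M. (\<Sum>n<N. \<bar>rep (\<mu> (P n)) x\<bar>) \<le> g x)"

lemma variation_leD:
  assumes "variation_le M \<Omega> \<A> \<mu> g" "P \<in> partitions \<Omega> \<A>"
  shows "AE x in M. (\<Sum>n<N. \<bar>rep (\<mu> (P n)) x\<bar>) \<le> g x"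
  using assms by (auto simp: variation_le_def)

text \<open>Bounds are functions while the lattice consists of classes; this is the passage from the
  former to the latter.\<close>

lemma variation_le_cls:
  assumes g: "g \<in> borel_measurable M" "variation_le M \<Omega> \<A> \<mu> g"
  shows "variation_le M \<Omega> \<A> \<mu> (rep (cls M g))"
  unfolding variation_le_def
proof (intro ballI allI)
  fix P N assume "P \<in> partitions \<Omega> \<A>"
  from variation_leD[OF g(2) this, of N] rep_cls[OF g(1)]
  show "AE x in M. (\<Sum>n<N. \<bar>rep (\<mu> (P n)) x\<bar>) \<le> rep (cls M g) x"
    by eventually_elim auto
qed

text \<open>Padding with empty sets turns the pair of \<open>A\<close> and its complement into a
  countable partition. Its first term alone gives the estimate for the single set \<open>A\<close>;
  for empty \<open>A\<close> it witnesses that partitions exist.\<close>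

definition split_partition :: "'o set \<Rightarrow> 'o set \<Rightarrow> nat \<Rightarrow> 'o set" where
  "split_partition \<Omega> A = (\<lambda>n. if n = 0 then A else if n = 1 then \<Omega> - A else {})"

context sigma_algebra
begin

lemma split_partition:
  assumes "A \<in> M"
  shows "split_partition \<Omega> A \<in> partitions \<Omega> M"
  using assms sets_into_space[OF assms]
  by (auto simp: split_partition_def partitions_def disjoint_family_on_def split: if_splits)

lemma variation_le_abs:
  assumes "variation_le N \<Omega> M \<mu> g" "A \<in> M"
  shows "AE x in N. \<bar>rep (\<mu> A) x\<bar> \<le> g x"
  using variation_leD[OF assms(1) split_partition[OF assms(2)], of 1]
  by (simp add: split_partition_def)

text \<open>A disjoint sequence extends to a partition of the whole space by prepending the complement
  of its union.\<close>

lemma variation_le_disjoint: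
  fixes A :: "nat \<Rightarrow> 'a set"
  assumes "variation_le N \<Omega> M \<mu> g" "range A \<subseteq> M" "disjoint_family A"
  shows "AE x in N. (\<Sum>n<k. \<bar>rep (\<mu> (A n)) x\<bar>) \<le> g x"
proof -
  define P where "P = case_nat (\<Omega> - (\<Union>n. A n)) A"
  have "(\<Union>n. A n) \<in> M"
    using assms(2) by (rule countable_UN)
  then have "P n \<in> M" for n
    using assms(2) by (auto simp: P_def split: nat.split)
  moreover have "disjoint_family P"
    using assms(3) unfolding P_def disjoint_family_on_def
    by (intro ballI impI; rename_tac i j; case_tac i; case_tac j) auto
  moreover have "(\<Union>n. P n) = \<Omega>"
  proof (intro equalityI subsetI)
    fix x assume "x \<in> \<Omega>"
    then have "x \<in> P 0 \<or> (\<exists>n. x \<in> P (Suc n))"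
      by (auto simp: P_def)
    then show "x \<in> (\<Union>n. P n)" by blast
  next
    fix x assume "x \<in> (\<Union>n. P n)"
    then obtain n where "x \<in> P n" by auto
    then show "x \<in> \<Omega>"
      using sets_into_space[OF \<open>P n \<in> M\<close>] by auto
  qed
  ultimately have "P \<in> partitions \<Omega> M"
    by (auto simp: partitions_def)
  \<comment> \<open>One of the \<open>Suc k\<close> terms is spent on the complement; it is
    nonnegative and is dropped.\<close>
  from variation_leD[OF assms(1) this, of "Suc k"]
  show ?thesis
    unfolding sum.lessThan_Suc_shift by eventually_elim (simp add: P_def)
qed

end

section \<open>The variation as a least upper bound\<close>

context finite_measure
begin

context
  fixes \<Omega> :: "'o set" and \<A> and \<mu> :: "'o set \<Rightarrow> ('a, real) ae_class"
  assumes \<mu>: "\<mu> \<in> \<A> \<rightarrow> ae_classes M"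
begin

lemma L0_abs_measure_closed: "range P \<subseteq> \<A> \<Longrightarrow> L0_abs M (\<mu> (P n)) \<in> ae_classes M"
  using \<mu> by (intro L0_closed) auto

lemma L0_suminf_measure_closed:
  "range P \<subseteq> \<A> \<Longrightarrow> L0_suminf M (\<lambda>n. L0_abs M (\<mu> (P n))) \<in> ae_classes M"
  using L0_abs_measure_closed by (intro L0_suminf_closed)

lemma L0_variation_closed: "L0_variation M \<A> \<mu> \<Omega> \<in> ae_classes M"
  unfolding L0_variation_def
  using L0_suminf_measure_closed by (intro Sup_L0_bar_closed) blast

text \<open>The variation is a supremum over partitions of suprema over partial sums; lying below
  \<open>v\<close> unfolds both layers into one family of almost everywhere inequalities.\<close>

lemma L0_variation_le_iff:
  assumes v: "v \<in> ae_classes M"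
  shows "ae_le M (L0_variation M \<A> \<mu> \<Omega>) v \<longleftrightarrow>
    (\<forall>P\<in>partitions \<Omega> \<A>. \<forall>N. AE x in M. ereal (\<Sum>n<N. \<bar>rep (\<mu> (P n)) x\<bar>) \<le> rep v x)"
proof -
  have "ae_le M (L0_suminf M (\<lambda>n. L0_abs M (\<mu> (P n)))) v
      \<longleftrightarrow> (\<forall>N. AE x in M. ereal (\<Sum>n<N. \<bar>rep (\<mu> (P n)) x\<bar>) \<le> rep v x)"
    if P: "P \<in> partitions \<Omega> \<A>" for P
  proof -
    have P': "\<mu> (P n) \<in> ae_classes M" for n
      using P \<mu> by (auto simp: partitions_def)
    have "AE x in M. \<forall>n. rep (L0_abs M (\<mu> (P n))) x = \<bar>rep (\<mu> (P n)) x\<bar>"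
      using P' by (simp add: AE_all_countable rep_abs)
    then have "(AE x in M. ereal (\<Sum>n<N. rep (L0_abs M (\<mu> (P n))) x) \<le> rep v x)
        \<longleftrightarrow> (AE x in M. ereal (\<Sum>n<N. \<bar>rep (\<mu> (P n)) x\<bar>) \<le> rep v x)" for N
      by (intro eventually_cong) auto
    then show ?thesis
      using P' v by (subst L0_suminf_le_iff) auto
  qed
  moreover have "ae_le M (L0_variation M \<A> \<mu> \<Omega>) v
      \<longleftrightarrow> (\<forall>P\<in>partitions \<Omega> \<A>. ae_le M (L0_suminf M (\<lambda>n. L0_abs M (\<mu> (P n)))) v)"
    unfolding L0_variation_def partitions_def
    by (subst Sup_L0_bar_le_iff[OF _ v]) (use L0_suminf_measure_closed in blast)+
  ultimately show ?thesis by auto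
qed

lemma L0_variation_le_real_iff:
  assumes g: "g \<in> ae_classes M"
  shows "ae_le M (L0_variation M \<A> \<mu> \<Omega>) (to_bar M g) \<longleftrightarrow> variation_le M \<Omega> \<A> \<mu> (rep g)"
proof -
  have "(AE x in M. ereal (\<Sum>n<N. \<bar>rep (\<mu> (P n)) x\<bar>) \<le> rep (to_bar M g) x)
      \<longleftrightarrow> (AE x in M. (\<Sum>n<N. \<bar>rep (\<mu> (P n)) x\<bar>) \<le> rep g x)"
    for P :: "nat \<Rightarrow> 'o set" and N
    using rep_to_bar[OF g] by (intro eventually_cong) auto
  then show ?thesis
    using g by (subst L0_variation_le_iff) (auto simp: variation_le_def)
qed

text \<open>A real bound forces the variation to be finite almost everywhere, and the empty partial
  sum forces it to be nonnegative, so it is the image of a nonnegative real class. Conversely that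
  class is a bound.\<close>

lemma bounded_variation_iff:
  assumes "sigma_algebra \<Omega> \<A>"
  shows "bounded_variation M \<Omega> \<A> \<mu> \<longleftrightarrow> (\<exists>g\<in>borel_measurable M. variation_le M \<Omega> \<A> \<mu> g)"
proof
  assume "bounded_variation M \<Omega> \<A> \<mu>"
  then obtain g where g: "g \<in> L0_pos M" "L0_variation M \<A> \<mu> \<Omega> = to_bar M g"
    unfolding bounded_variation_def by blast
  have "ae_le M (L0_variation M \<A> \<mu> \<Omega>) (to_bar M g)"
    by (simp add: g ae_le_def)
  then show "\<exists>g\<in>borel_measurable M. variation_le M \<Omega> \<A> \<mu> g"
    using L0_variation_le_real_iff[of g] rep_measurable[of g M] g(1)
    by (intro bexI[of _ "rep g"]) (auto simp: L0_pos_iff)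
next
  interpret A: sigma_algebra \<Omega> \<A> by fact
  assume "\<exists>g\<in>borel_measurable M. variation_le M \<Omega> \<A> \<mu> g"
  then obtain g where g: "g \<in> borel_measurable M" "variation_le M \<Omega> \<A> \<mu> g"
    by auto
  define v where "v = L0_variation M \<A> \<mu> \<Omega>"
  have v [simp]: "v \<in> ae_classes M"
    unfolding v_def by (rule L0_variation_closed)
  note variation_le_cls[OF g]
  then have "ae_le M v (to_bar M (cls M g))"
    using g(1) by (simp add: L0_variation_le_real_iff v_def cls_in_ae_classes)
  then have le: "AE x in M. rep v x < \<infinity>"
    using rep_to_bar[OF cls_in_ae_classes[OF g(1)]] unfolding ae_le_def
    by eventually_elim (auto intro: le_less_trans)
  have "ae_le M v v" by (simp add: ae_le_def)
  then have "\<forall>P\<in>partitions \<Omega> \<A>. \<forall>N. AE x in M. ereal (\<Sum>n<N. \<bar>rep (\<mu> (P n)) x\<bar>) \<le> rep v x"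
    using L0_variation_le_iff[OF v] by (simp only: v_def)
  \<comment> \<open>Any partition would do here: \<open>N = 0\<close> gives the empty sum, hence the
    lower bound 0.\<close>
  from spec[OF bspec[OF this A.split_partition[OF A.empty_sets]], of 0]
  have ge: "AE x in M. 0 \<le> rep v x"
    by (simp add: zero_ereal_def)
  \<comment> \<open>\<open>real_of_ereal\<close> sends infinite values to 0, but by
    \<open>le\<close> and \<open>ge\<close> they occur only on a null set.\<close>
  define h where "h = cls M (\<lambda>x. real_of_ereal (rep v x))"
  have h [simp]: "h \<in> ae_classes M" and rep_h: "AE x in M. rep h x = real_of_ereal (rep v x)"
    by (auto simp: h_def intro!: rep_cls)
  have "to_bar M h = v"
  proof (rule ae_class_eqI[of _ M])
    show "AE x in M. rep (to_bar M h) x = rep v x"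
      using rep_to_bar[OF h] rep_h le ge by eventually_elim (auto simp: ereal_real)
  qed auto
  moreover have "AE x in M. 0 \<le> rep h x"
    using rep_h ge by eventually_elim (auto simp: real_of_ereal_pos)
  ultimately show "bounded_variation M \<Omega> \<A> \<mu>"
    unfolding bounded_variation_def v_def[symmetric] by (intro image_eqI[of _ _ h]) (auto simp: L0_pos_iff)
qed

context
  assumes bv: "bounded_variation M \<Omega> \<A> \<mu>"
begin

lemma TV_norm_pos: "TV_norm M \<Omega> \<A> \<mu> \<in> L0_pos M"
  and to_bar_TV_norm: "to_bar M (TV_norm M \<Omega> \<A> \<mu>) = L0_variation M \<A> \<mu> \<Omega>"
proof -
  obtain g where g: "g \<in> L0_pos M" "L0_variation M \<A> \<mu> \<Omega> = to_bar M g"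
    using bv by (auto simp: bounded_variation_def)
  have "TV_norm M \<Omega> \<A> \<mu> = g"
    unfolding TV_norm_def g(2) using g(1)
    by (intro the_inv_into_f_f) (auto simp: inj_on_to_bar L0_pos_iff)
  then show "TV_norm M \<Omega> \<A> \<mu> \<in> L0_pos M"
      "to_bar M (TV_norm M \<Omega> \<A> \<mu>) = L0_variation M \<A> \<mu> \<Omega>"
    using g by auto
qed

lemma TV_norm_closed: "TV_norm M \<Omega> \<A> \<mu> \<in> ae_classes M"
  using TV_norm_pos by (simp add: L0_pos_iff)

lemma variation_le_TV_norm: "variation_le M \<Omega> \<A> \<mu> (rep (TV_norm M \<Omega> \<A> \<mu>))"
  using L0_variation_le_real_iff[OF TV_norm_closed] by (simp add: to_bar_TV_norm ae_le_def)

lemma TV_norm_le: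
  assumes g: "g \<in> borel_measurable M" "variation_le M \<Omega> \<A> \<mu> g"
  shows "AE x in M. rep (TV_norm M \<Omega> \<A> \<mu>) x \<le> g x"
proof -
  note variation_le_cls[OF g]
  then have "ae_le M (to_bar M (TV_norm M \<Omega> \<A> \<mu>)) (to_bar M (cls M g))"
    using L0_variation_le_real_iff[OF cls_in_ae_classes[OF g(1)]] by (simp add: to_bar_TV_norm)
  then show ?thesis
    using rep_to_bar[OF TV_norm_closed] rep_to_bar[OF cls_in_ae_classes[OF g(1)]] rep_cls[OF g(1)]
    unfolding ae_le_def by eventually_elim auto
qed

end
end
end

section \<open>Convergence in measure\<close>

context prob_space
begin

lemma integrable_min_1:
  fixes f :: "'a \<Rightarrow> real"
  assumes "f \<in> borel_measurable M" "AE x in M. 0 \<le> f x"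
  shows "integrable M (\<lambda>x. min (f x) 1)"
  using assms by (intro integrable_const_bound[where B = 1]) (auto elim!: eventually_mono)

lemma integral_min_1_eq_0_iff:
  fixes f :: "'a \<Rightarrow> real"
  assumes "f \<in> borel_measurable M" "AE x in M. 0 \<le> f x"
  shows "(\<integral>x. min (f x) 1 \<partial>M) = 0 \<longleftrightarrow> (AE x in M. f x = 0)"
proof -
  have "AE x in M. 0 \<le> min (f x) 1"
    using assms(2) by eventually_elim simp
  then have "(\<integral>x. min (f x) 1 \<partial>M) = 0 \<longleftrightarrow> (AE x in M. min (f x) 1 = 0)"
    by (rule integral_nonneg_eq_0_iff_AE[OF integrable_min_1[OF assms]])
  also have "\<dots> \<longleftrightarrow> (AE x in M. f x = 0)"
    by (intro eventually_cong refl AE_I2) (auto simp: min_def)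
  finally show ?thesis .
qed

text \<open>Truncation at 1 is subadditive on nonnegative numbers.\<close>

lemma integral_min_1_triangle:
  fixes f g h :: "'a \<Rightarrow> real"
  assumes "f \<in> borel_measurable M" "AE x in M. 0 \<le> f x"
    and "g \<in> borel_measurable M" "AE x in M. 0 \<le> g x"
    and "h \<in> borel_measurable M" "AE x in M. 0 \<le> h x"
    and "AE x in M. f x \<le> g x + h x"
  shows "(\<integral>x. min (f x) 1 \<partial>M) \<le> (\<integral>x. min (g x) 1 \<partial>M) + (\<integral>x. min (h x) 1 \<partial>M)"
proof -
  have "AE x in M. min (f x) 1 \<le> min (g x) 1 + min (h x) 1"
    using assms(4,6,7) by eventually_elim (auto simp: min_def)
  then have "(\<integral>x. min (f x) 1 \<partial>M) \<le> (\<integral>x. min (g x) 1 + min (h x) 1 \<partial>M)"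
    using assms by (intro integral_mono_AE Bochner_Integration.integrable_add integrable_min_1)
  also have "\<dots> = (\<integral>x. min (g x) 1 \<partial>M) + (\<integral>x. min (h x) 1 \<partial>M)"
    using assms by (intro Bochner_Integration.integral_add integrable_min_1)
  finally show ?thesis .
qed

lemma integral_min_1_tendsto_0:
  fixes f :: "nat \<Rightarrow> 'a \<Rightarrow> real"
  assumes meas: "\<And>n. f n \<in> borel_measurable M"
    and nonneg: "\<And>n. AE x in M. 0 \<le> f n x"
    and lim: "AE x in M. (\<lambda>n. f n x) \<longlonglongrightarrow> 0"
  shows "(\<lambda>n. \<integral>x. min (f n x) 1 \<partial>M) \<longlonglongrightarrow> 0"
proof -
  have "(\<lambda>n. \<integral>x. min (f n x) 1 \<partial>M) \<longlonglongrightarrow> (\<integral>x. 0 \<partial>M)"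
  proof (rule integral_dominated_convergence[where w = "\<lambda>_. 1"])
    show "AE x in M. (\<lambda>n. min (f n x) 1) \<longlonglongrightarrow> 0"
      using lim by eventually_elim (auto dest: tendsto_min[OF _ tendsto_const[of 1]])
    show "AE x in M. norm (min (f n x) 1) \<le> 1" for n
      using nonneg[of n] by eventually_elim auto
  qed (use meas in auto)
  then show ?thesis by simp
qed

text \<open>Interchanging sum and integral shows that the truncated series has finite integral,
  hence is finite almost everywhere. Its terms then tend to 0, so from some index on they are below
  1 and the truncation is inactive.\<close>

lemma AE_summable_of_integral_min_1:
  fixes f :: "nat \<Rightarrow> 'a \<Rightarrow> real"
  assumes meas: "\<And>n. f n \<in> borel_measurable M"
    and nonneg: "\<And>n. AE x in M. 0 \<le> f n x"
    and bound: "\<And>n. (\<integral>x. min (f n x) 1 \<partial>M) \<le> c n" and c: "summable c"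
  shows "AE x in M. summable (\<lambda>n. f n x)"
proof -
  note [measurable] = meas
  have c0: "0 \<le> c n" for n
  proof -
    have "0 \<le> (\<integral>x. min (f n x) 1 \<partial>M)"
      using nonneg[of n] by (intro integral_nonneg_AE) (auto elim!: eventually_mono)
    with bound[of n] show ?thesis by simp
  qed
  have "(\<integral>\<^sup>+x. ennreal (min (f n x) 1) \<partial>M) \<le> ennreal (c n)" for n
  proof -
    have "(\<integral>\<^sup>+x. ennreal (min (f n x) 1) \<partial>M) = ennreal (\<integral>x. min (f n x) 1 \<partial>M)"
      using nonneg[of n]
      by (intro nn_integral_eq_integral integrable_min_1 meas) (auto elim!: eventually_mono)
    then show ?thesis
      using bound by (simp add: ennreal_leI)
  qed
  then have "(\<Sum>n. \<integral>\<^sup>+x. ennreal (min (f n x) 1) \<partial>M) \<le> (\<Sum>n. ennreal (c n))"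
    by (intro suminf_le) auto
  also have "\<dots> < \<infinity>"
    using c c0 by (simp add: suminf_ennreal2)
  finally have "(\<integral>\<^sup>+x. (\<Sum>n. ennreal (min (f n x) 1)) \<partial>M) \<noteq> \<infinity>"
    by (subst nn_integral_suminf) auto
  then have "AE x in M. (\<Sum>n. ennreal (min (f n x) 1)) \<noteq> \<infinity>"
    by (intro nn_integral_noteq_infinite) auto
  moreover have "AE x in M. \<forall>n. 0 \<le> f n x"
    using nonneg by (simp add: AE_all_countable)
  ultimately show ?thesis
  proof eventually_elim
    case (elim x)
    then have "summable (\<lambda>n. min (f n x) 1)"
      by (intro summable_suminf_not_top) auto
    moreover from this have "eventually (\<lambda>n. min (f n x) 1 < 1) sequentially"
      by (intro order_tendstoD(2)[OF summable_LIMSEQ_zero]) auto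
    then have "eventually (\<lambda>n. f n x = min (f n x) 1) sequentially"
      by eventually_elim (auto simp: min_def split: if_splits)
    ultimately show ?case
      by (subst summable_cong)
  qed
qed

section \<open>The metric on real classes and its relation to almost everywhere convergence\<close>

lemma Metric_space_L0: "Metric_space (ae_classes M) (L0_dist M)"
proof
  fix u v w :: "('a, real) ae_class"
  show "0 \<le> L0_dist M u v"
    unfolding L0_dist_def by (rule Bochner_Integration.integral_nonneg) simp
  show "L0_dist M u v = L0_dist M v u"
    by (simp add: L0_dist_def abs_minus_commute)
  assume u: "u \<in> ae_classes M" and v: "v \<in> ae_classes M"
  note [measurable] = rep_measurable[OF u] rep_measurable[OF v]
  have "L0_dist M u v = 0 \<longleftrightarrow> (AE x in M. \<bar>rep u x - rep v x\<bar> = 0)"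
    unfolding L0_dist_def by (rule integral_min_1_eq_0_iff) auto
  also have "\<dots> \<longleftrightarrow> u = v"
    using ae_class_eqI[OF u v] by auto
  finally show "L0_dist M u v = 0 \<longleftrightarrow> u = v" .
  assume w: "w \<in> ae_classes M"
  note [measurable] = rep_measurable[OF w]
  show "L0_dist M u w \<le> L0_dist M u v + L0_dist M v w"
    unfolding L0_dist_def by (rule integral_min_1_triangle) auto
qed

text \<open>Dominated convergence, applied to differences truncated at 1. The converse fails for
  general sequences, hence the summability assumption in
  \<open>limitin_L0_partial_sums_iff\<close>.\<close>

lemma limitin_L0_of_AE:
  assumes u: "\<And>n. u n \<in> ae_classes M" and l: "l \<in> ae_classes M"
    and lim: "AE x in M. (\<lambda>n. rep (u n) x) \<longlonglongrightarrow> rep l x"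
  shows "limitin (Metric_space.mtopology (carrier (L0 M)) (L0_dist M)) u l sequentially"
proof -
  interpret Metric_space "ae_classes M" "L0_dist M"
    by (rule Metric_space_L0)
  note [measurable] = rep_measurable[OF u] rep_measurable[OF l]
  have "AE x in M. (\<lambda>n. \<bar>rep (u n) x - rep l x\<bar>) \<longlonglongrightarrow> 0"
    using lim by eventually_elim (simp add: LIM_zero tendsto_rabs_zero)
  then have "(\<lambda>n. L0_dist M (u n) l) \<longlonglongrightarrow> 0"
    unfolding L0_dist_def by (intro integral_min_1_tendsto_0) auto
  then show ?thesis
    using u l by (simp add: limitin_metric_dist_null)
qed

lemma L0_summable_abs_iff:
  assumes u: "\<And>n. u n \<in> ae_classes M"
  shows "L0_summable M (\<lambda>n. L0_abs M (u n)) \<longleftrightarrow> (AE x in M. summable (\<lambda>n. \<bar>rep (u n) x\<bar>))"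
proof -
  note [measurable] = rep_measurable[OF u]
  have pos: "L0_abs M (u n) \<in> L0_pos M" for n
    using rep_abs[OF u[of n]] u by (auto simp: L0_pos_iff elim: eventually_mono)
  have "AE x in M. \<forall>n. rep (L0_abs M (u n)) x = \<bar>rep (u n) x\<bar>"
    using u by (simp add: AE_all_countable rep_abs)
  moreover have "AE x in M. \<forall>N. rep (\<Oplus>\<^bsub>L0 M\<^esub>n\<in>{..<N}. L0_abs M (u n)) x
      = (\<Sum>n<N. rep (L0_abs M (u n)) x)"
    using u by (intro AE_all_countable[THEN iffD2] allI rep_finsum) auto
  ultimately have sums: "AE x in M. \<forall>N. rep (\<Oplus>\<^bsub>L0 M\<^esub>n\<in>{..<N}. L0_abs M (u n)) x
      = (\<Sum>n<N. \<bar>rep (u n) x\<bar>)"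
    by eventually_elim auto
  have "(\<exists>b\<in>carrier (L0 M). \<forall>N. ae_le M (\<Oplus>\<^bsub>L0 M\<^esub>n\<in>{..<N}. L0_abs M (u n)) b)
      \<longleftrightarrow> (AE x in M. summable (\<lambda>n. \<bar>rep (u n) x\<bar>))"
  proof
    assume "\<exists>b\<in>carrier (L0 M). \<forall>N. ae_le M (\<Oplus>\<^bsub>L0 M\<^esub>n\<in>{..<N}. L0_abs M (u n)) b"
    then obtain b where "\<forall>N. AE x in M. rep (\<Oplus>\<^bsub>L0 M\<^esub>n\<in>{..<N}. L0_abs M (u n)) x \<le> rep b x"
      by (auto simp: ae_le_def)
    then have "AE x in M. \<forall>N. rep (\<Oplus>\<^bsub>L0 M\<^esub>n\<in>{..<N}. L0_abs M (u n)) x \<le> rep b x"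
      by (simp add: AE_all_countable)
    with sums show "AE x in M. summable (\<lambda>n. \<bar>rep (u n) x\<bar>)"
    proof eventually_elim
      case (elim x)
      then show ?case
        by (intro summableI_nonneg_bounded[where x = "rep b x"]) auto
    qed
  next
    assume *: "AE x in M. summable (\<lambda>n. \<bar>rep (u n) x\<bar>)"
    \<comment> \<open>Where the series diverges \<open>b\<close> has a meaningless value, which by
      \<open>*\<close> concerns only a null set.\<close>
    define b where "b = cls M (\<lambda>x. \<Sum>n. \<bar>rep (u n) x\<bar>)"
    have b: "b \<in> carrier (L0 M)"
      by (auto simp: b_def)
    have rep_b: "AE x in M. rep b x = (\<Sum>n. \<bar>rep (u n) x\<bar>)"
      unfolding b_def by (intro rep_cls) measurable
    have "ae_le M (\<Oplus>\<^bsub>L0 M\<^esub>n\<in>{..<N}. L0_abs M (u n)) b" for N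
      unfolding ae_le_def using rep_b * sums
      by eventually_elim (auto intro: sum_le_suminf)
    with b show "\<exists>b\<in>carrier (L0 M). \<forall>N. ae_le M (\<Oplus>\<^bsub>L0 M\<^esub>n\<in>{..<N}. L0_abs M (u n)) b"
      by blast
  qed
  then show ?thesis
    using pos by (simp add: L0_summable_def)
qed

text \<open>Summability supplies an almost everywhere sum \<open>t\<close>, which is also a limit in
  the metric. Uniqueness of metric limits identifies it with \<open>s\<close>, so no passage to
  subsequences is required.\<close>

lemma limitin_L0_partial_sums_iff:
  assumes u: "\<And>n. u n \<in> ae_classes M" and s: "s \<in> ae_classes M"
    and summable: "AE x in M. summable (\<lambda>n. rep (u n) x)"
  shows "limitin (Metric_space.mtopology (carrier (L0 M)) (L0_dist M))
      (\<lambda>N. \<Oplus>\<^bsub>L0 M\<^esub>n\<in>{..<N}. u n) s sequentially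
    \<longleftrightarrow> (AE x in M. (\<lambda>n. rep (u n) x) sums rep s x)"
proof -
  interpret L0: Metric_space "ae_classes M" "L0_dist M"
    by (rule Metric_space_L0)
  note [measurable] = rep_measurable[OF u]
  have "AE x in M. \<forall>N. rep (\<Oplus>\<^bsub>L0 M\<^esub>n\<in>{..<N}. u n) x = (\<Sum>n<N. rep (u n) x)"
    using u by (intro AE_all_countable[THEN iffD2] allI rep_finsum) auto
  then have lim: "limitin (Metric_space.mtopology (carrier (L0 M)) (L0_dist M))
      (\<lambda>N. \<Oplus>\<^bsub>L0 M\<^esub>n\<in>{..<N}. u n) t sequentially"
    if "t \<in> ae_classes M" "AE x in M. (\<lambda>n. rep (u n) x) sums rep t x" for t
    using that(2) by (intro limitin_L0_of_AE that(1) finsum_L0_closed u)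
      (auto simp: sums_def elim: eventually_elim2)
  define t where "t = cls M (\<lambda>x. \<Sum>n. rep (u n) x)"
  have t: "t \<in> ae_classes M"
    by (auto simp: t_def)
  have "AE x in M. rep t x = (\<Sum>n. rep (u n) x)"
    unfolding t_def by (intro rep_cls) measurable
  with summable have sums_t: "AE x in M. (\<lambda>n. rep (u n) x) sums rep t x"
    by eventually_elim (auto intro: summable_sums)
  show ?thesis
  proof
    assume "limitin (Metric_space.mtopology (carrier (L0 M)) (L0_dist M))
      (\<lambda>N. \<Oplus>\<^bsub>L0 M\<^esub>n\<in>{..<N}. u n) s sequentially"
    from L0.limitin_metric_unique[OF this[unfolded carrier_L0] lim[OF t sums_t, unfolded carrier_L0]]
    have "s = t"
      by simp
    then show "AE x in M. (\<lambda>n. rep (u n) x) sums rep s x"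
      using sums_t by simp
  qed (rule lim[OF s])
qed

end

section \<open>Measures with values in the real classes\<close>

locale L0_measure_space = prob_space M + A: sigma_algebra \<Omega> \<A>
  for M :: "'a measure" and \<Omega> :: "'o set" and \<A> :: "'o set set"
begin

abbreviation "V \<equiv> L0_measures M \<Omega> \<A>"
abbreviation "tv \<equiv> TV_norm M \<Omega> \<A>"

text \<open>Only plain convergence is recorded: in \<open>carrier_V_iff\<close> absolute convergence
  comes from the variation bound.\<close>

definition sigma_additive :: "('o set \<Rightarrow> ('a, real) ae_class) \<Rightarrow> bool" where
  "sigma_additive \<mu> \<longleftrightarrow> (\<forall>A. range A \<subseteq> \<A> \<longrightarrow> disjoint_family A \<longrightarrow>
    (AE x in M. (\<lambda>n. rep (\<mu> (A n)) x) sums rep (\<mu> (\<Union>n. A n)) x))"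

text \<open>A variation bound dominates every partial sum of the absolute values along a disjoint
  sequence. This yields the order bounded partial sums in the definition of a measure, and
  \<open>limitin_L0_partial_sums_iff\<close> then turns metric convergence into almost everywhere
  convergence. The case split isolates the conditions that permit these conversions; when they fail,
  so do both sides.\<close>

lemma carrier_V_iff:
  "\<mu> \<in> carrier V \<longleftrightarrow> \<mu> \<in> \<A> \<rightarrow>\<^sub>E ae_classes M \<and> sigma_additive \<mu> \<and>
    (\<exists>g\<in>borel_measurable M. variation_le M \<Omega> \<A> \<mu> g)"
proof (cases "\<mu> \<in> \<A> \<rightarrow>\<^sub>E ae_classes M \<and> (\<exists>g\<in>borel_measurable M. variation_le M \<Omega> \<A> \<mu> g)")
  case True
  then have \<mu>: "\<mu> A \<in> ae_classes M" if "A \<in> \<A>" for A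
    using that by auto
  obtain g where g: "variation_le M \<Omega> \<A> \<mu> g"
    using True by auto
  have abs_summable: "AE x in M. summable (\<lambda>n. \<bar>rep (\<mu> (A n)) x\<bar>)"
    if "range A \<subseteq> \<A>" "disjoint_family A" for A :: "nat \<Rightarrow> 'o set"
  proof -
    have "AE x in M. \<forall>N. (\<Sum>n<N. \<bar>rep (\<mu> (A n)) x\<bar>) \<le> g x"
      using A.variation_le_disjoint[OF g that] by (simp add: AE_all_countable)
    then show ?thesis
      by eventually_elim (auto intro: summableI_nonneg_bounded)
  qed
  have "L0_summable M (\<lambda>n. L0_abs M (\<mu> (A n))) \<and>
      limitin (Metric_space.mtopology (carrier (L0 M)) (L0_dist M))
        (\<lambda>N. \<Oplus>\<^bsub>L0 M\<^esub>n\<in>{..<N}. \<mu> (A n)) (\<mu> (\<Union>n. A n)) sequentially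
      \<longleftrightarrow> (AE x in M. (\<lambda>n. rep (\<mu> (A n)) x) sums rep (\<mu> (\<Union>n. A n)) x)"
    if A: "range A \<subseteq> \<A>" "disjoint_family A" for A :: "nat \<Rightarrow> 'o set"
  proof -
    have "(\<Union>n. A n) \<in> \<A>"
      using A(1) by (rule A.countable_UN)
    moreover have "\<mu> (A n) \<in> ae_classes M" for n
      using A(1) by (intro \<mu>) auto
    moreover have "AE x in M. summable (\<lambda>n. rep (\<mu> (A n)) x)"
      using abs_summable[OF A] by eventually_elim (rule summable_rabs_cancel)
    ultimately show ?thesis
      using abs_summable[OF A] \<mu>
      by (simp add: L0_summable_abs_iff limitin_L0_partial_sums_iff[unfolded carrier_L0])
  qed
  then have "L0_measure M \<A> \<mu> \<longleftrightarrow> \<mu> {} = \<zero>\<^bsub>L0 M\<^esub> \<and> sigma_additive \<mu>"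
    using True by (auto simp: L0_measure_def sigma_additive_def)
  also have "\<dots> \<longleftrightarrow> sigma_additive \<mu>"
  proof -
    have "\<mu> {} = \<zero>\<^bsub>L0 M\<^esub>" if "sigma_additive \<mu>"
    proof (rule ae_class_eqI)
      \<comment> \<open>The constant sequence of empty sets is disjoint, and a convergent series
        with constant terms has terms 0.\<close>
      have "AE x in M. (\<lambda>n. rep (\<mu> {}) x) sums rep (\<mu> {}) x"
        using that[unfolded sigma_additive_def, rule_format, of "\<lambda>_. {}"]
        by (simp add: disjoint_family_on_def)
      with rep_zero[of M] show "AE x in M. rep (\<mu> {}) x = rep \<zero>\<^bsub>L0 M\<^esub> x"
          by eventually_elim (auto dest!: sums_summable summable_LIMSEQ_zero simp: LIMSEQ_const_iff)
    qed (use \<mu> in auto)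
    then show ?thesis by auto
  qed
  finally show ?thesis
    using True bounded_variation_iff[of \<mu> \<A> \<Omega>] A.sigma_algebra_axioms
    by (auto simp: L0_measures_def)
next
  case False
  then show ?thesis
    using bounded_variation_iff[of \<mu> \<A> \<Omega>] A.sigma_algebra_axioms
    by (auto simp: L0_measures_def L0_measure_def)
qed

lemma carrier_VD:
  assumes "\<mu> \<in> carrier V"
  shows V_closed: "A \<in> \<A> \<Longrightarrow> \<mu> A \<in> ae_classes M"
    and V_sigma_additive: "sigma_additive \<mu>"
    and V_bounded_variation: "bounded_variation M \<Omega> \<A> \<mu>"
    and V_funcset: "\<mu> \<in> \<A> \<rightarrow> ae_classes M"
  using assms carrier_V_iff[of \<mu>] by (auto simp: L0_measures_def)

lemma sigma_additiveD:
  assumes "sigma_additive \<mu>" "range A \<subseteq> \<A>" "disjoint_family A"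
  shows "AE x in M. (\<lambda>n. rep (\<mu> (A n)) x) sums rep (\<mu> (\<Union>n. A n)) x"
  using assms by (auto simp: sigma_additive_def)

lemma V_eqI:
  assumes "\<mu> \<in> carrier V" "\<nu> \<in> carrier V" "\<And>A. A \<in> \<A> \<Longrightarrow> \<mu> A = \<nu> A"
  shows "\<mu> = \<nu>"
proof (rule PiE_ext)
  show "\<mu> \<in> \<A> \<rightarrow>\<^sub>E ae_classes M" "\<nu> \<in> \<A> \<rightarrow>\<^sub>E ae_classes M"
    using assms(1,2) by (simp_all add: carrier_V_iff)
qed (rule assms(3))

lemma tv_pos: "\<mu> \<in> carrier V \<Longrightarrow> tv \<mu> \<in> L0_pos M"
  by (intro TV_norm_pos V_funcset V_bounded_variation)

lemma tv_closed: "\<mu> \<in> carrier V \<Longrightarrow> tv \<mu> \<in> ae_classes M"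
  using tv_pos by (simp add: L0_pos_iff)

lemma variation_le_tv: "\<mu> \<in> carrier V \<Longrightarrow> variation_le M \<Omega> \<A> \<mu> (rep (tv \<mu>))"
  by (intro variation_le_TV_norm V_funcset V_bounded_variation)

lemma tv_le:
  assumes "\<mu> \<in> carrier V" "g \<in> borel_measurable M" "variation_le M \<Omega> \<A> \<mu> g"
  shows "AE x in M. rep (tv \<mu>) x \<le> g x"
  using assms by (intro TV_norm_le V_funcset V_bounded_variation)

section \<open>Module operations on measures and their variation bounds\<close>

lemma V_apply:
  assumes "A \<in> \<A>"
  shows V_zero_apply: "\<zero>\<^bsub>V\<^esub> A = \<zero>\<^bsub>L0 M\<^esub>"
    and V_add_apply: "(\<mu> \<oplus>\<^bsub>V\<^esub> \<nu>) A = \<mu> A \<oplus>\<^bsub>L0 M\<^esub> \<nu> A"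
    and V_smult_apply: "(f \<odot>\<^bsub>V\<^esub> \<mu>) A = f \<otimes>\<^bsub>L0 M\<^esub> \<mu> A"
  using assms by (simp_all add: L0_measures_def)

lemma rep_V_add:
  assumes "\<mu> \<in> carrier V" "\<nu> \<in> carrier V" "A \<in> \<A>"
  shows "AE x in M. rep ((\<mu> \<oplus>\<^bsub>V\<^esub> \<nu>) A) x = rep (\<mu> A) x + rep (\<nu> A) x"
  using assms by (simp add: V_apply rep_add V_closed)

lemma rep_V_smult:
  assumes "f \<in> ae_classes M" "\<mu> \<in> carrier V" "A \<in> \<A>"
  shows "AE x in M. rep ((f \<odot>\<^bsub>V\<^esub> \<mu>) A) x = rep f x * rep (\<mu> A) x"
  using assms by (simp add: V_apply rep_mult V_closed)

lemma partitionD: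
  assumes "P \<in> partitions \<Omega> \<A>"
  shows "P n \<in> \<A>"
  using assms by (auto simp: partitions_def)

lemma variation_le_zero: "variation_le M \<Omega> \<A> \<zero>\<^bsub>V\<^esub> (\<lambda>_. 0)"
  unfolding variation_le_def
proof (intro ballI allI)
  fix P :: "nat \<Rightarrow> 'o set" and N assume "P \<in> partitions \<Omega> \<A>"
  then show "AE x in M. (\<Sum>n<N. \<bar>rep (\<zero>\<^bsub>V\<^esub> (P n)) x\<bar>) \<le> 0"
    using rep_zero[of M] by (simp add: V_zero_apply partitionD) (auto elim: eventually_mono)
qed

lemma V_zero_closed: "\<zero>\<^bsub>V\<^esub> \<in> carrier V"
proof -
  have "sigma_additive \<zero>\<^bsub>V\<^esub>"
    unfolding sigma_additive_def
  proof (intro allI impI)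
    fix A :: "nat \<Rightarrow> 'o set" assume A: "range A \<subseteq> \<A>"
    then have "A n \<in> \<A>" "(\<Union>n. A n) \<in> \<A>" for n
      by auto
    then show "AE x in M. (\<lambda>n. rep (\<zero>\<^bsub>V\<^esub> (A n)) x) sums rep (\<zero>\<^bsub>V\<^esub> (\<Union>n. A n)) x"
      using rep_zero[of M] by (simp add: V_zero_apply) (auto elim: eventually_mono)
  qed
  moreover note variation_le_zero
  moreover have "\<zero>\<^bsub>V\<^esub> \<in> \<A> \<rightarrow>\<^sub>E ae_classes M"
    by (auto simp: L0_measures_def)
  ultimately show ?thesis
    unfolding carrier_V_iff by (intro conjI bexI[of _ "\<lambda>_. 0"]) auto
qed

lemma variation_le_add:
  assumes \<mu>: "\<mu> \<in> carrier V" "variation_le M \<Omega> \<A> \<mu> g"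
    and \<nu>: "\<nu> \<in> carrier V" "variation_le M \<Omega> \<A> \<nu> h"
  shows "variation_le M \<Omega> \<A> (\<mu> \<oplus>\<^bsub>V\<^esub> \<nu>) (\<lambda>x. g x + h x)"
  unfolding variation_le_def
proof (intro ballI allI)
  fix P :: "nat \<Rightarrow> 'o set" and N assume P: "P \<in> partitions \<Omega> \<A>"
  have "AE x in M. \<forall>n. rep ((\<mu> \<oplus>\<^bsub>V\<^esub> \<nu>) (P n)) x = rep (\<mu> (P n)) x + rep (\<nu> (P n)) x"
    using P \<mu> \<nu> by (simp add: AE_all_countable rep_V_add partitionD)
  with variation_leD[OF \<mu>(2) P, of N] variation_leD[OF \<nu>(2) P, of N]
  show "AE x in M. (\<Sum>n<N. \<bar>rep ((\<mu> \<oplus>\<^bsub>V\<^esub> \<nu>) (P n)) x\<bar>) \<le> g x + h x"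
  proof eventually_elim
    case (elim x)
    have "(\<Sum>n<N. \<bar>rep ((\<mu> \<oplus>\<^bsub>V\<^esub> \<nu>) (P n)) x\<bar>)
        \<le> (\<Sum>n<N. \<bar>rep (\<mu> (P n)) x\<bar> + \<bar>rep (\<nu> (P n)) x\<bar>)"
      using elim(3) by (intro sum_mono) (simp add: abs_triangle_ineq)
    then show ?case
      using elim(1,2) by (simp add: sum.distrib)
  qed
qed

lemma variation_le_smult:
  assumes f: "f \<in> ae_classes M" and \<mu>: "\<mu> \<in> carrier V" "variation_le M \<Omega> \<A> \<mu> g"
  shows "variation_le M \<Omega> \<A> (f \<odot>\<^bsub>V\<^esub> \<mu>) (\<lambda>x. \<bar>rep f x\<bar> * g x)"
  unfolding variation_le_def
proof (intro ballI allI)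
  fix P :: "nat \<Rightarrow> 'o set" and N assume P: "P \<in> partitions \<Omega> \<A>"
  have "AE x in M. \<forall>n. rep ((f \<odot>\<^bsub>V\<^esub> \<mu>) (P n)) x = rep f x * rep (\<mu> (P n)) x"
    using P f \<mu> by (simp add: AE_all_countable rep_V_smult partitionD)
  with variation_leD[OF \<mu>(2) P, of N]
  show "AE x in M. (\<Sum>n<N. \<bar>rep ((f \<odot>\<^bsub>V\<^esub> \<mu>) (P n)) x\<bar>) \<le> \<bar>rep f x\<bar> * g x"
    by eventually_elim (simp add: abs_mult sum_distrib_left[symmetric] mult_left_mono)
qed

lemma V_add_closed:
  assumes \<mu>: "\<mu> \<in> carrier V" and \<nu>: "\<nu> \<in> carrier V"
  shows "\<mu> \<oplus>\<^bsub>V\<^esub> \<nu> \<in> carrier V"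
proof -
  have "sigma_additive (\<mu> \<oplus>\<^bsub>V\<^esub> \<nu>)"
    unfolding sigma_additive_def
  proof (intro allI impI)
    fix A :: "nat \<Rightarrow> 'o set" assume A: "range A \<subseteq> \<A>" "disjoint_family A"
    then have "A n \<in> \<A>" "(\<Union>n. A n) \<in> \<A>" for n
      by auto
    then have "AE x in M. \<forall>n. rep ((\<mu> \<oplus>\<^bsub>V\<^esub> \<nu>) (A n)) x = rep (\<mu> (A n)) x + rep (\<nu> (A n)) x"
      and "AE x in M. rep ((\<mu> \<oplus>\<^bsub>V\<^esub> \<nu>) (\<Union>n. A n)) x = rep (\<mu> (\<Union>n. A n)) x + rep (\<nu> (\<Union>n. A n)) x"
      using \<mu> \<nu> by (simp_all add: AE_all_countable rep_V_add)
    with sigma_additiveD[OF V_sigma_additive[OF \<mu>] A] sigma_additiveD[OF V_sigma_additive[OF \<nu>] A]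
    show "AE x in M. (\<lambda>n. rep ((\<mu> \<oplus>\<^bsub>V\<^esub> \<nu>) (A n)) x) sums rep ((\<mu> \<oplus>\<^bsub>V\<^esub> \<nu>) (\<Union>n. A n)) x"
      by eventually_elim (simp add: sums_add)
  qed
  moreover have "\<exists>g\<in>borel_measurable M. variation_le M \<Omega> \<A> (\<mu> \<oplus>\<^bsub>V\<^esub> \<nu>) g"
    using variation_le_add[OF \<mu> variation_le_tv[OF \<mu>] \<nu> variation_le_tv[OF \<nu>]]
      rep_measurable[OF tv_closed[OF \<mu>]] rep_measurable[OF tv_closed[OF \<nu>]]
    by (intro bexI[of _ "\<lambda>x. rep (tv \<mu>) x + rep (tv \<nu>) x"]) auto
  moreover have "\<mu> \<oplus>\<^bsub>V\<^esub> \<nu> \<in> \<A> \<rightarrow>\<^sub>E ae_classes M"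
    using \<mu> \<nu> by (auto simp: L0_measures_def V_closed[unfolded L0_measures_def])
  ultimately show ?thesis
    unfolding carrier_V_iff by blast
qed

lemma V_smult_closed:
  assumes f: "f \<in> ae_classes M" and \<mu>: "\<mu> \<in> carrier V"
  shows "f \<odot>\<^bsub>V\<^esub> \<mu> \<in> carrier V"
proof -
  have "sigma_additive (f \<odot>\<^bsub>V\<^esub> \<mu>)"
    unfolding sigma_additive_def
  proof (intro allI impI)
    fix A :: "nat \<Rightarrow> 'o set" assume A: "range A \<subseteq> \<A>" "disjoint_family A"
    then have "A n \<in> \<A>" "(\<Union>n. A n) \<in> \<A>" for n
      by auto
    then have "AE x in M. \<forall>n. rep ((f \<odot>\<^bsub>V\<^esub> \<mu>) (A n)) x = rep f x * rep (\<mu> (A n)) x"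
      and "AE x in M. rep ((f \<odot>\<^bsub>V\<^esub> \<mu>) (\<Union>n. A n)) x = rep f x * rep (\<mu> (\<Union>n. A n)) x"
      using f \<mu> by (simp_all add: AE_all_countable rep_V_smult)
    with sigma_additiveD[OF V_sigma_additive[OF \<mu>] A]
    show "AE x in M. (\<lambda>n. rep ((f \<odot>\<^bsub>V\<^esub> \<mu>) (A n)) x) sums rep ((f \<odot>\<^bsub>V\<^esub> \<mu>) (\<Union>n. A n)) x"
      by eventually_elim (simp add: sums_mult)
  qed
  moreover have "\<exists>g\<in>borel_measurable M. variation_le M \<Omega> \<A> (f \<odot>\<^bsub>V\<^esub> \<mu>) g"
    using variation_le_smult[OF f \<mu> variation_le_tv[OF \<mu>]]
      rep_measurable[OF tv_closed[OF \<mu>]] rep_measurable[OF f]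
    by (intro bexI[of _ "\<lambda>x. \<bar>rep f x\<bar> * rep (tv \<mu>) x"]) auto
  moreover have "f \<odot>\<^bsub>V\<^esub> \<mu> \<in> \<A> \<rightarrow>\<^sub>E ae_classes M"
    using f \<mu> by (auto simp: L0_measures_def V_closed[unfolded L0_measures_def])
  ultimately show ?thesis
    unfolding carrier_V_iff by blast
qed

text \<open>A measure in the carrier is determined by its values on \<open>\<A>\<close>, so
  \<open>V_eqI\<close> reduces the module laws to ring laws of \<open>L0 M\<close>, applied set by
  set.\<close>

lemma module_V: "Module.module (L0 M) V"
proof -
  interpret R: cring "L0 M" by (rule cring_L0)
  note closed = V_zero_closed V_add_closed V_smult_closed
  have group: "abelian_group V"
  proof (rule abelian_groupI)
    fix \<mu> assume \<mu>: "\<mu> \<in> carrier V"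
    have m1: "\<ominus>\<^bsub>L0 M\<^esub> \<one>\<^bsub>L0 M\<^esub> \<in> ae_classes M"
      using R.a_inv_closed[OF R.one_closed] by simp
    show "\<exists>\<nu>\<in>carrier V. \<nu> \<oplus>\<^bsub>V\<^esub> \<mu> = \<zero>\<^bsub>V\<^esub>"
    proof (rule bexI)
      \<comment> \<open>The negative of \<mu> is taken as its multiple by -1, so closure under
        scalars covers it.\<close>
      show "(\<ominus>\<^bsub>L0 M\<^esub> \<one>\<^bsub>L0 M\<^esub>) \<odot>\<^bsub>V\<^esub> \<mu> \<oplus>\<^bsub>V\<^esub> \<mu> = \<zero>\<^bsub>V\<^esub>"
        using \<mu> m1
        by (intro V_eqI closed) (auto simp: V_apply V_closed R.l_minus R.l_neg)
    qed (intro closed \<mu> m1)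
  qed (auto intro!: V_eqI closed simp: V_apply V_closed R.a_ac)
  show ?thesis
    by (rule moduleI) (auto intro!: cring_L0 group V_eqI closed
      simp: V_apply V_closed R.l_distr R.r_distr R.m_assoc)
qed

lemma random_normed_module_V: "random_normed_module M V tv"
proof -
  interpret module "L0 M" V by (rule module_V)
  show ?thesis
  proof
    fix \<mu> assume \<mu>: "\<mu> \<in> carrier V"
    show "tv \<mu> \<in> L0_pos M"
      using \<mu> by (rule tv_pos)
    show "tv \<mu> = \<zero>\<^bsub>L0 M\<^esub> \<longleftrightarrow> \<mu> = \<zero>\<^bsub>V\<^esub>"
    proof
      assume eq: "tv \<mu> = \<zero>\<^bsub>L0 M\<^esub>"
      have "\<mu> A = \<zero>\<^bsub>L0 M\<^esub>" if "A \<in> \<A>" for A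
      proof (rule ae_class_eqI)
        show "AE x in M. rep (\<mu> A) x = rep \<zero>\<^bsub>L0 M\<^esub> x"
          using A.variation_le_abs[OF variation_le_tv[OF \<mu>] that] rep_zero[of M] unfolding eq
          by eventually_elim auto
      qed (use V_closed[OF \<mu> that] in auto)
      then show "\<mu> = \<zero>\<^bsub>V\<^esub>"
        by (intro V_eqI \<mu> V_zero_closed) (simp add: V_zero_apply)
    next
      assume eq: "\<mu> = \<zero>\<^bsub>V\<^esub>"
      have "AE x in M. rep (tv \<mu>) x \<le> 0"
        using variation_le_zero by (intro tv_le[OF \<mu>]) (auto simp: eq)
      moreover have "AE x in M. 0 \<le> rep (tv \<mu>) x"
        using tv_pos[OF \<mu>] by (simp add: L0_pos_iff)
      ultimately have "AE x in M. rep (tv \<mu>) x = rep \<zero>\<^bsub>L0 M\<^esub> x"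
        using rep_zero[of M] by eventually_elim auto
      then show "tv \<mu> = \<zero>\<^bsub>L0 M\<^esub>"
        by (intro ae_class_eqI[of _ M] tv_closed \<mu>) auto
    qed
    show "ae_le M (tv (\<mu> \<oplus>\<^bsub>V\<^esub> \<nu>)) (tv \<mu> \<oplus>\<^bsub>L0 M\<^esub> tv \<nu>)" if \<nu>: "\<nu> \<in> carrier V" for \<nu>
    proof -
      note [measurable] = rep_measurable[OF tv_closed[OF \<mu>]] rep_measurable[OF tv_closed[OF \<nu>]]
      have "AE x in M. rep (tv (\<mu> \<oplus>\<^bsub>V\<^esub> \<nu>)) x \<le> rep (tv \<mu>) x + rep (tv \<nu>) x"
        by (intro tv_le V_add_closed variation_le_add variation_le_tv \<mu> \<nu>) measurable
      with rep_add[OF tv_closed[OF \<mu>] tv_closed[OF \<nu>]] show ?thesis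
        unfolding ae_le_def by eventually_elim simp
    qed
    show "tv (f \<odot>\<^bsub>V\<^esub> \<mu>) = L0_abs M f \<otimes>\<^bsub>L0 M\<^esub> tv \<mu>" if "f \<in> carrier (L0 M)" for f
    proof -
      have f: "f \<in> ae_classes M" using that by simp
      have f\<mu>: "f \<odot>\<^bsub>V\<^esub> \<mu> \<in> carrier V" by (intro V_smult_closed f \<mu>)
      note [measurable] = rep_measurable[OF tv_closed[OF \<mu>]] rep_measurable[OF tv_closed[OF f\<mu>]]
        rep_measurable[OF f]
      have le: "AE x in M. rep (tv (f \<odot>\<^bsub>V\<^esub> \<mu>)) x \<le> \<bar>rep f x\<bar> * rep (tv \<mu>) x"
        by (intro tv_le f\<mu> variation_le_smult variation_le_tv f \<mu>) measurable
      \<comment> \<open>For the reverse inequality one would divide by \<open>\<bar>f\<bar>\<close>,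
        which may vanish. Where it does, the claimed inequality is trivial and
        \<open>tv \<mu>\<close> itself serves as bound; elsewhere the quotient does. Minimality of
        \<open>tv \<mu>\<close> against \<open>h\<close> gives the claim after multiplying
        back.\<close>
      define h where "h x = (if rep f x = 0 then rep (tv \<mu>) x
        else rep (tv (f \<odot>\<^bsub>V\<^esub> \<mu>)) x / \<bar>rep f x\<bar>)" for x
      have "variation_le M \<Omega> \<A> \<mu> h"
        unfolding variation_le_def
      proof (intro ballI allI)
        fix P :: "nat \<Rightarrow> 'o set" and N assume P: "P \<in> partitions \<Omega> \<A>"
        have "AE x in M. \<forall>n. rep ((f \<odot>\<^bsub>V\<^esub> \<mu>) (P n)) x = rep f x * rep (\<mu> (P n)) x"
          using P f \<mu> by (simp add: AE_all_countable rep_V_smult partitionD)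
        with variation_leD[OF variation_le_tv[OF \<mu>] P, of N]
          variation_leD[OF variation_le_tv[OF f\<mu>] P, of N]
        show "AE x in M. (\<Sum>n<N. \<bar>rep (\<mu> (P n)) x\<bar>) \<le> h x"
          by eventually_elim
            (auto simp: h_def abs_mult sum_distrib_left[symmetric] field_simps)
      qed
      then have "AE x in M. rep (tv \<mu>) x \<le> h x"
        by (intro tv_le \<mu>) (auto simp: h_def[abs_def])
      moreover have "AE x in M. 0 \<le> rep (tv (f \<odot>\<^bsub>V\<^esub> \<mu>)) x"
        using tv_pos[OF f\<mu>] by (simp add: L0_pos_iff)
      ultimately have ge: "AE x in M. \<bar>rep f x\<bar> * rep (tv \<mu>) x \<le> rep (tv (f \<odot>\<^bsub>V\<^esub> \<mu>)) x"
        by eventually_elim (auto simp: h_def field_simps split: if_splits)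
      show ?thesis
      proof (rule ae_class_eqI[of _ M])
        show "AE x in M. rep (tv (f \<odot>\<^bsub>V\<^esub> \<mu>)) x = rep (L0_abs M f \<otimes>\<^bsub>L0 M\<^esub> tv \<mu>) x"
          using le ge rep_abs[OF f] rep_mult[OF L0_closed(5)[OF f] tv_closed[OF \<mu>]]
          by eventually_elim simp
      qed (auto intro: tv_closed f\<mu> \<mu> f)
    qed
  qed
qed

end

section \<open>The metric of a random normed module\<close>

context random_normed_module
begin

lemma nrm_closed: "v \<in> carrier V \<Longrightarrow> nrm v \<in> ae_classes M"
  using nrm_pos by (simp add: L0_pos_iff)

lemma rep_nrm_nonneg: "v \<in> carrier V \<Longrightarrow> AE x in M. 0 \<le> rep (nrm v) x"
  using nrm_pos by (simp add: L0_pos_iff)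

lemma rep_nrm_measurable: "v \<in> carrier V \<Longrightarrow> rep (nrm v) \<in> borel_measurable M"
  by (intro rep_measurable nrm_closed)

text \<open>Negation in \<open>V\<close> is only the abstract group inverse. As a scalar multiple it
  becomes accessible to the homogeneity of the norm and, for measures, to evaluation on a set in
  \<open>rep_V_minus\<close>.\<close>

lemma minus_one_smult: "v \<in> carrier V \<Longrightarrow> \<ominus>\<^bsub>V\<^esub> v = (\<ominus>\<^bsub>L0 M\<^esub> \<one>\<^bsub>L0 M\<^esub>) \<odot>\<^bsub>V\<^esub> v"
  by (subst smult_l_minus) auto

lemma nrm_uminus:
  assumes v: "v \<in> carrier V"
  shows "nrm (\<ominus>\<^bsub>V\<^esub> v) = nrm v"
proof (rule ae_class_eqI[of _ M])
  have m1: "\<ominus>\<^bsub>L0 M\<^esub> \<one>\<^bsub>L0 M\<^esub> \<in> ae_classes M"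
    using R.a_inv_closed[OF R.one_closed] by simp
  have "nrm (\<ominus>\<^bsub>V\<^esub> v) = L0_abs M (\<ominus>\<^bsub>L0 M\<^esub> \<one>\<^bsub>L0 M\<^esub>) \<otimes>\<^bsub>L0 M\<^esub> nrm v"
    using v m1 by (simp add: minus_one_smult nrm_smult)
  moreover have "AE x in M. rep (L0_abs M (\<ominus>\<^bsub>L0 M\<^esub> \<one>\<^bsub>L0 M\<^esub>) \<otimes>\<^bsub>L0 M\<^esub> nrm v) x = rep (nrm v) x"
    using rep_mult[OF L0_closed(5)[OF m1] nrm_closed[OF v]] rep_abs[OF m1]
      rep_a_inv[OF L0_closed(2)] rep_one[of M]
    by eventually_elim simp
  ultimately show "AE x in M. rep (nrm (\<ominus>\<^bsub>V\<^esub> v)) x = rep (nrm v) x"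
    by simp
qed (use v in \<open>auto intro: nrm_closed\<close>)

lemma nrm_minus_commute:
  assumes "v \<in> carrier V" "w \<in> carrier V"
  shows "nrm (v \<ominus>\<^bsub>V\<^esub> w) = nrm (w \<ominus>\<^bsub>V\<^esub> v)"
proof -
  have "\<ominus>\<^bsub>V\<^esub> (v \<ominus>\<^bsub>V\<^esub> w) = w \<ominus>\<^bsub>V\<^esub> v"
    using assms by (simp add: M.minus_eq M.minus_add M.a_comm)
  then show ?thesis
    using nrm_uminus[of "v \<ominus>\<^bsub>V\<^esub> w"] assms by simp
qed

lemma rep_nrm_triangle:
  assumes u: "u \<in> carrier V" and v: "v \<in> carrier V" and w: "w \<in> carrier V"
  shows "AE x in M. rep (nrm (u \<ominus>\<^bsub>V\<^esub> w)) x \<le> rep (nrm (u \<ominus>\<^bsub>V\<^esub> v)) x + rep (nrm (v \<ominus>\<^bsub>V\<^esub> w)) x"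
proof -
  have "u \<ominus>\<^bsub>V\<^esub> w = (u \<ominus>\<^bsub>V\<^esub> v) \<oplus>\<^bsub>V\<^esub> (v \<ominus>\<^bsub>V\<^esub> w)"
    using assms by (simp add: M.minus_eq M.a_assoc M.r_neg1)
  then have "ae_le M (nrm (u \<ominus>\<^bsub>V\<^esub> w)) (nrm (u \<ominus>\<^bsub>V\<^esub> v) \<oplus>\<^bsub>L0 M\<^esub> nrm (v \<ominus>\<^bsub>V\<^esub> w))"
    using nrm_triangle[of "u \<ominus>\<^bsub>V\<^esub> v" "v \<ominus>\<^bsub>V\<^esub> w"] assms by simp
  moreover have "u \<ominus>\<^bsub>V\<^esub> v \<in> carrier V" "v \<ominus>\<^bsub>V\<^esub> w \<in> carrier V"
    using assms by auto
  note rep_add[OF this[THEN nrm_closed]]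
  ultimately show ?thesis
    unfolding ae_le_def by eventually_elim simp
qed

lemma rn_dist_eq:
  "\<lbrakk>v \<in> carrier V; w \<in> carrier V\<rbrakk> \<Longrightarrow>
    rn_dist M V nrm v w = (\<integral>x. min (rep (nrm (v \<ominus>\<^bsub>V\<^esub> w)) x) 1 \<partial>M)"
  by (simp add: rn_dist_def)

lemma rn_dist_eq_0_iff:
  assumes "v \<in> carrier V" "w \<in> carrier V"
  shows "rn_dist M V nrm v w = 0 \<longleftrightarrow> v = w"
proof -
  have vw: "v \<ominus>\<^bsub>V\<^esub> w \<in> carrier V"
    using assms by simp
  have "rn_dist M V nrm v w = 0 \<longleftrightarrow> (AE x in M. rep (nrm (v \<ominus>\<^bsub>V\<^esub> w)) x = 0)"
    using assms by (simp add: rn_dist_eq integral_min_1_eq_0_iff rep_nrm_measurable rep_nrm_nonneg)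
  also have "\<dots> \<longleftrightarrow> nrm (v \<ominus>\<^bsub>V\<^esub> w) = \<zero>\<^bsub>L0 M\<^esub>"
  proof
    assume "AE x in M. rep (nrm (v \<ominus>\<^bsub>V\<^esub> w)) x = 0"
    with rep_zero[of M] have "AE x in M. rep (nrm (v \<ominus>\<^bsub>V\<^esub> w)) x = rep \<zero>\<^bsub>L0 M\<^esub> x"
      by eventually_elim simp
    then show "nrm (v \<ominus>\<^bsub>V\<^esub> w) = \<zero>\<^bsub>L0 M\<^esub>"
      by (intro ae_class_eqI[of _ M] nrm_closed vw) auto
  qed (simp add: rep_zero)
  also have "\<dots> \<longleftrightarrow> v \<ominus>\<^bsub>V\<^esub> w = \<zero>\<^bsub>V\<^esub>"
    by (rule nrm_eq_zero_iff[OF vw])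
  also have "\<dots> \<longleftrightarrow> v = w"
    using M.add.inv_solve_right[of "\<zero>\<^bsub>V\<^esub>" v w] assms by (auto simp: M.minus_eq)
  finally show ?thesis .
qed

lemma Metric_space_rn_dist: "Metric_space (carrier V) (rn_dist M V nrm)"
proof
  fix u v w
  show "0 \<le> rn_dist M V nrm u v"
  proof (cases "u \<in> carrier V \<and> v \<in> carrier V")
    case True
    then show ?thesis
      using rep_nrm_nonneg[of "u \<ominus>\<^bsub>V\<^esub> v"]
      by (auto simp: rn_dist_eq intro!: integral_nonneg_AE elim: eventually_mono)
  qed (auto simp: rn_dist_def)
  show "rn_dist M V nrm u v = rn_dist M V nrm v u"
    using nrm_minus_commute by (auto simp: rn_dist_def)
  assume "u \<in> carrier V" "v \<in> carrier V"
  then show "rn_dist M V nrm u v = 0 \<longleftrightarrow> u = v"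
    by (rule rn_dist_eq_0_iff)
  assume "w \<in> carrier V"
  with \<open>u \<in> carrier V\<close> \<open>v \<in> carrier V\<close>
  show "rn_dist M V nrm u w \<le> rn_dist M V nrm u v + rn_dist M V nrm v w"
    by (auto simp: rn_dist_eq
      intro!: integral_min_1_triangle rep_nrm_measurable rep_nrm_nonneg rep_nrm_triangle)
qed

text \<open>Completeness only has to be tested on sequences whose increments are almost everywhere
  absolutely summable, since every Cauchy sequence has such a subsequence.\<close>

lemma mcomplete_rn_dist:
  assumes lim: "\<And>v. \<lbrakk>\<And>k. v k \<in> carrier V;
      AE x in M. summable (\<lambda>k. rep (nrm (v (Suc k) \<ominus>\<^bsub>V\<^esub> v k)) x)\<rbrakk>
    \<Longrightarrow> \<exists>w\<in>carrier V. AE x in M. (\<lambda>k. rep (nrm (v k \<ominus>\<^bsub>V\<^esub> w)) x) \<longlonglongrightarrow> 0"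
  shows "Metric_space.mcomplete (carrier V) (rn_dist M V nrm)"
proof -
  interpret D: Metric_space "carrier V" "rn_dist M V nrm"
    by (rule Metric_space_rn_dist)
  show ?thesis
    unfolding D.mcomplete_def
  proof (intro allI impI)
    fix \<sigma> assume cau: "D.MCauchy \<sigma>"
    then have \<sigma>: "\<sigma> n \<in> carrier V" for n
      by (auto simp: D.MCauchy_def)
    \<comment> \<open>The geometric thresholds are chosen for their summability, which
      \<open>AE_summable_of_integral_min_1\<close> asks of the distances between successive
      terms.\<close>
    have "\<exists>N. \<forall>n n'. N \<le> n \<longrightarrow> N \<le> n' \<longrightarrow> rn_dist M V nrm (\<sigma> n) (\<sigma> n') < (1/2)^k" for k :: nat
      using cau unfolding D.MCauchy_def by simp
    then obtain N where N: "\<And>k n n'. \<lbrakk>N k \<le> n; N k \<le> n'\<rbrakk> \<Longrightarrow>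
        rn_dist M V nrm (\<sigma> n) (\<sigma> n') < (1/2)^k"
      by metis
    \<comment> \<open>The successor makes \<open>r\<close> strictly increasing; the maximum keeps
      \<open>r k\<close> beyond the Cauchy threshold \<open>N k\<close>.\<close>
    define r where "r = rec_nat (N 0) (\<lambda>k rk. max (Suc rk) (N (Suc k)))"
    have r_Suc: "r (Suc k) = max (Suc (r k)) (N (Suc k))" for k
      by (simp add: r_def)
    have "strict_mono r"
      by (rule strict_monoI_Suc) (simp add: r_Suc)
    have N_le: "N k \<le> r k" for k
      by (cases k) (simp_all add: r_def)
    define v where "v = \<sigma> \<circ> r"
    have v: "v k \<in> carrier V" for k
      by (simp add: v_def \<sigma>)
    have "AE x in M. summable (\<lambda>k. rep (nrm (v (Suc k) \<ominus>\<^bsub>V\<^esub> v k)) x)"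
    proof (rule AE_summable_of_integral_min_1)
      fix k
      have "rn_dist M V nrm (v (Suc k)) (v k) < (1/2)^k"
        unfolding v_def o_def
        using N_le[of k] \<open>strict_mono r\<close>[THEN strict_monoD, of k "Suc k"] by (intro N) auto
      then show "(\<integral>x. min (rep (nrm (v (Suc k) \<ominus>\<^bsub>V\<^esub> v k)) x) 1 \<partial>M) \<le> (1/2)^k"
        using v by (simp add: rn_dist_eq)
    qed (auto intro: rep_nrm_measurable rep_nrm_nonneg v)
    from lim[OF v this] obtain w where w: "w \<in> carrier V"
        "AE x in M. (\<lambda>k. rep (nrm (v k \<ominus>\<^bsub>V\<^esub> w)) x) \<longlonglongrightarrow> 0"
      by blast
    then have "(\<lambda>k. rn_dist M V nrm (v k) w) \<longlonglongrightarrow> 0"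
      using v by (simp add: rn_dist_eq)
        (intro integral_min_1_tendsto_0 rep_nrm_measurable rep_nrm_nonneg, auto)
    then have "limitin D.mtopology (\<sigma> \<circ> r) w sequentially"
      using w(1) v by (simp add: D.limitin_metric_dist_null v_def)
    then show "\<exists>x. limitin D.mtopology \<sigma> x sequentially"
      using D.MCauchy_convergent_subsequence[OF cau \<open>strict_mono r\<close>] by blast
  qed
qed

end

section \<open>Completeness of the space of measures\<close>

text \<open>The whole sum over \<open>I\<close> is telescoped in the sequence index before passing
  to the limit, so the resulting tail does not depend on \<open>I\<close>.\<close>

lemma sum_abs_diff_le_tail:
  fixes a :: "nat \<Rightarrow> 'i \<Rightarrow> real"
  assumes step: "\<And>k. (\<Sum>i\<in>I. \<bar>a (Suc k) i - a k i\<bar>) \<le> g k" and g: "summable g"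
    and lim: "\<And>i. i \<in> I \<Longrightarrow> (\<lambda>k. a k i) \<longlonglongrightarrow> b i"
  shows "(\<Sum>i\<in>I. \<bar>a k i - b i\<bar>) \<le> (\<Sum>j. g (j + k))"
proof (rule LIMSEQ_le_const2)
  show "(\<lambda>m. \<Sum>i\<in>I. \<bar>a k i - a (m + k) i\<bar>) \<longlonglongrightarrow> (\<Sum>i\<in>I. \<bar>a k i - b i\<bar>)"
    using lim by (intro tendsto_intros LIMSEQ_ignore_initial_segment)
  have g0: "0 \<le> g k" for k
    using order_trans[OF _ step] by (simp add: sum_nonneg)
  have "(\<Sum>i\<in>I. \<bar>a k i - a (m + k) i\<bar>) \<le> (\<Sum>j<m. g (j + k))" for m
  proof (induction m)
    case (Suc m)
    have "(\<Sum>i\<in>I. \<bar>a k i - a (Suc m + k) i\<bar>)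
        \<le> (\<Sum>i\<in>I. \<bar>a k i - a (m + k) i\<bar> + \<bar>a (Suc (m + k)) i - a (m + k) i\<bar>)"
      by (intro sum_mono) simp
    also have "\<dots> \<le> (\<Sum>j<m. g (j + k)) + g (m + k)"
      using Suc step[of "m + k"] by (simp add: sum.distrib)
    finally show ?case by simp
  qed simp
  also have "(\<Sum>j<m. g (j + k)) \<le> (\<Sum>j. g (j + k))" for m
    using g g0 by (intro sum_le_suminf) (simp_all add: summable_iff_shift)
  finally show "\<exists>N. \<forall>m\<ge>N. (\<Sum>i\<in>I. \<bar>a k i - a (m + k) i\<bar>) \<le> (\<Sum>j. g (j + k))"
    by blast
qed

text \<open>An interchange of limits: \<open>G k\<close> controls the error of all partial sums at
  once, so \<open>k\<close> can be fixed before the number of terms is sent to infinity.\<close>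

lemma sums_of_uniform_approximation:
  fixes a :: "nat \<Rightarrow> nat \<Rightarrow> real"
  assumes sums: "\<And>k. a k sums s k"
    and approx: "\<And>k N. (\<Sum>n<N. \<bar>a k n - b n\<bar>) \<le> G k" "\<And>k. \<bar>s k - t\<bar> \<le> G k"
    and G: "G \<longlonglongrightarrow> 0"
  shows "b sums t"
  unfolding sums_def
proof (rule LIMSEQ_I)
  fix \<epsilon> :: real assume "\<epsilon> > 0"
  then obtain k where k: "G k < \<epsilon> / 3"
    using order_tendstoD(2)[OF G, of "\<epsilon> / 3"] by (auto simp: eventually_sequentially)
  obtain N where N: "\<And>m. m \<ge> N \<Longrightarrow> norm ((\<Sum>n<m. a k n) - s k) < \<epsilon> / 3"
    using LIMSEQ_D[OF sums[unfolded sums_def], of "\<epsilon> / 3" k] \<open>\<epsilon> > 0\<close> by auto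
  have "norm ((\<Sum>n<m. b n) - t) < \<epsilon>" if "m \<ge> N" for m
  proof -
    have "\<bar>(\<Sum>n<m. a k n) - (\<Sum>n<m. b n)\<bar> \<le> (\<Sum>n<m. \<bar>a k n - b n\<bar>)"
      unfolding sum_subtractf[symmetric] by (rule sum_abs)
    then have "\<bar>(\<Sum>n<m. a k n) - (\<Sum>n<m. b n)\<bar> < \<epsilon> / 3"
      using approx(1)[of k m] k by simp
    moreover have "\<bar>s k - t\<bar> < \<epsilon> / 3"
      using approx(2)[of k] k by simp
    ultimately show ?thesis
      using N[OF that] by (simp add: abs_if split: if_splits)
  qed
  then show "\<exists>N. \<forall>m\<ge>N. norm ((\<Sum>n<m. b n) - t) < \<epsilon>"
    by blast
qed

context L0_measure_space
begin

lemma rep_V_minus: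
  assumes "\<mu> \<in> carrier V" "\<nu> \<in> carrier V" "A \<in> \<A>"
  shows "AE x in M. rep ((\<mu> \<ominus>\<^bsub>V\<^esub> \<nu>) A) x = rep (\<mu> A) x - rep (\<nu> A) x"
proof -
  interpret random_normed_module M V tv
    by (rule random_normed_module_V)
  have m1: "\<ominus>\<^bsub>L0 M\<^esub> \<one>\<^bsub>L0 M\<^esub> \<in> ae_classes M"
    using R.a_inv_closed[OF R.one_closed] by simp
  have \<nu>: "(\<ominus>\<^bsub>L0 M\<^esub> \<one>\<^bsub>L0 M\<^esub>) \<odot>\<^bsub>V\<^esub> \<nu> \<in> carrier V"
    using assms(2) m1 by (intro V_smult_closed)
  have eq: "\<mu> \<ominus>\<^bsub>V\<^esub> \<nu> = \<mu> \<oplus>\<^bsub>V\<^esub> (\<ominus>\<^bsub>L0 M\<^esub> \<one>\<^bsub>L0 M\<^esub>) \<odot>\<^bsub>V\<^esub> \<nu>"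
    using assms by (simp add: a_minus_def minus_one_smult)
  show ?thesis
    unfolding eq using rep_V_add[OF assms(1) \<nu> assms(3)] rep_V_smult[OF m1 assms(2,3)]
      rep_a_inv[OF L0_closed(2)] rep_one[of M]
    by eventually_elim simp
qed

lemma summable_increments_converge:
  assumes v: "\<And>k. v k \<in> carrier V"
    and summable: "AE x in M. summable (\<lambda>k. rep (tv (v (Suc k) \<ominus>\<^bsub>V\<^esub> v k)) x)"
  shows "\<exists>w\<in>carrier V. AE x in M. (\<lambda>k. rep (tv (v k \<ominus>\<^bsub>V\<^esub> w)) x) \<longlonglongrightarrow> 0"
proof -
  interpret V: random_normed_module M V tv
    by (rule random_normed_module_V)
  define g where "g k = rep (tv (v (Suc k) \<ominus>\<^bsub>V\<^esub> v k))" for k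
  have dv: "v (Suc k) \<ominus>\<^bsub>V\<^esub> v k \<in> carrier V" for k
    using v by simp
  have [measurable]: "g k \<in> borel_measurable M" for k
    unfolding g_def by (intro rep_measurable tv_closed dv)
  have g: "AE x in M. summable (\<lambda>k. g k x)"
    using summable by (simp add: g_def)
  define G where "G k x = (\<Sum>j. g (j + k) x)" for k x
  have [measurable]: "G k \<in> borel_measurable M" for k
    unfolding G_def by measurable
  have G_0: "AE x in M. (\<lambda>k. G k x) \<longlonglongrightarrow> 0"
    using g
  proof eventually_elim
    case (elim x)
    show ?case
      unfolding G_def suminf_minus_initial_segment[OF elim]
      using tendsto_diff[OF tendsto_const[of "\<Sum>j. g j x"] summable_LIMSEQ[OF elim]]
      by simp
  qed
  have v_meas [measurable]: "rep (v k A) \<in> borel_measurable M" if "A \<in> \<A>" for k A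
    by (intro rep_measurable V_closed v that)
  \<comment> \<open>Where the sequence diverges \<open>lim\<close> has an unspecified value; by
    \<open>w_lim\<close> this affects only a null set, which depends on \<open>A\<close>. The
    restriction to \<open>\<A>\<close> provides the extensionality demanded of measures.\<close>
  define w where "w = (\<lambda>A\<in>\<A>. cls M (\<lambda>x. lim (\<lambda>k. rep (v k A) x)))"
  have w_closed: "w A \<in> ae_classes M" if "A \<in> \<A>" for A
    using that v_meas[OF that] by (auto simp: w_def intro!: cls_in_ae_classes borel_measurable_lim_metric)
  have step: "AE x in M. \<forall>k. (\<Sum>n<N. \<bar>rep (v (Suc k) (A n)) x - rep (v k (A n)) x\<bar>) \<le> g k x"
    if A: "range A \<subseteq> \<A>" "disjoint_family A" for A :: "nat \<Rightarrow> 'o set" and N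
    unfolding AE_all_countable
  proof
    fix k
    have "AE x in M. \<forall>n. rep ((v (Suc k) \<ominus>\<^bsub>V\<^esub> v k) (A n)) x
        = rep (v (Suc k) (A n)) x - rep (v k (A n)) x"
      unfolding AE_all_countable using A(1) by (intro allI rep_V_minus v) auto
    with A.variation_le_disjoint[OF variation_le_tv[OF dv[of k]] A, of N]
    show "AE x in M. (\<Sum>n<N. \<bar>rep (v (Suc k) (A n)) x - rep (v k (A n)) x\<bar>) \<le> g k x"
      by eventually_elim (simp add: g_def)
  qed
  have w_lim: "AE x in M. (\<lambda>k. rep (v k A) x) \<longlonglongrightarrow> rep (w A) x" if A: "A \<in> \<A>" for A
  proof -
    \<comment> \<open>A single set padded with empty sets is a disjoint sequence, so
      \<open>step\<close> with one term bounds the increments on \<open>A\<close> itself by the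
      summable \<open>g\<close>.\<close>
    define B :: "nat \<Rightarrow> 'o set" where "B n = (if n = 0 then A else {})" for n
    have B: "range B \<subseteq> \<A>" "disjoint_family B"
      using A by (auto simp: B_def disjoint_family_on_def)
    have "AE x in M. rep (w A) x = lim (\<lambda>k. rep (v k A) x)"
      using A v_meas[OF A] by (auto simp: w_def intro!: rep_cls borel_measurable_lim_metric)
    with g step[OF B, of 1] show ?thesis
    proof eventually_elim
      case (elim x)
      have "summable (\<lambda>k. \<bar>rep (v (Suc k) A) x - rep (v k A) x\<bar>)"
        using elim(2) by (intro summable_comparison_test[OF _ elim(1)]) (auto simp: B_def)
      then have "summable (\<lambda>k. rep (v (Suc k) A) x - rep (v k A) x)"
        by (rule summable_rabs_cancel)
      then have "convergent (\<lambda>k. rep (v k A) x)"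
        unfolding summable_iff_convergent sum_lessThan_telescope[of "\<lambda>k. rep (v k A) x"]
        by (simp add: convergent_diff_const_right_iff)
      then show ?case
        using elim(3) by (simp add: convergent_LIMSEQ_iff)
    qed
  qed
  have close: "AE x in M. \<forall>k N. (\<Sum>n<N. \<bar>rep (v k (A n)) x - rep (w (A n)) x\<bar>) \<le> G k x"
    if A: "range A \<subseteq> \<A>" "disjoint_family A" for A :: "nat \<Rightarrow> 'o set"
  proof -
    have "AE x in M. \<forall>n. (\<lambda>k. rep (v k (A n)) x) \<longlonglongrightarrow> rep (w (A n)) x"
      unfolding AE_all_countable using A(1) by (intro allI w_lim) auto
    moreover have "AE x in M. \<forall>N k. (\<Sum>n<N. \<bar>rep (v (Suc k) (A n)) x - rep (v k (A n)) x\<bar>) \<le> g k x"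
      by (subst AE_all_countable) (intro allI step A)
    ultimately show ?thesis
      using g by eventually_elim (auto simp: G_def intro!: sum_abs_diff_le_tail)
  qed
  have "sigma_additive w"
    unfolding sigma_additive_def
  proof (intro allI impI)
    fix A :: "nat \<Rightarrow> 'o set" assume A: "range A \<subseteq> \<A>" "disjoint_family A"
    \<comment> \<open>The same padding applied to the union: \<open>close\<close> with one term
      bounds the error there by the same \<open>G k\<close> as the error of the partial
      sums.\<close>
    define B :: "nat \<Rightarrow> 'o set" where "B n = (if n = 0 then (\<Union>n. A n) else {})" for n
    have B: "range B \<subseteq> \<A>" "disjoint_family B"
      using A(1) by (auto simp: B_def disjoint_family_on_def)
    have "AE x in M. \<forall>k. (\<lambda>n. rep (v k (A n)) x) sums rep (v k (\<Union>n. A n)) x"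
      unfolding AE_all_countable by (intro allI sigma_additiveD[OF V_sigma_additive[OF v] A])
    with G_0 close[OF A] close[OF B]
    show "AE x in M. (\<lambda>n. rep (w (A n)) x) sums rep (w (\<Union>n. A n)) x"
    proof eventually_elim
      case (elim x)
      show ?case
      proof (rule sums_of_uniform_approximation)
        show "(\<lambda>n. rep (v k (A n)) x) sums rep (v k (\<Union>n. A n)) x" for k
          by (rule spec[OF elim(4)])
        show "(\<Sum>n<N. \<bar>rep (v k (A n)) x - rep (w (A n)) x\<bar>) \<le> G k x" for k N
          by (rule spec[OF spec[OF elim(2)]])
        show "\<bar>rep (v k (\<Union>n. A n)) x - rep (w (\<Union>n. A n)) x\<bar> \<le> G k x" for k
          using spec[OF spec[OF elim(3), of k], of 1] by (simp add: B_def)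
      qed (rule elim(1))
    qed
  qed
  moreover have "\<exists>h\<in>borel_measurable M. variation_le M \<Omega> \<A> w h"
  proof (rule bexI)
    \<comment> \<open>Compare \<open>w\<close> with the initial term \<open>v 0\<close>, from which
      it differs in variation by at most \<open>G 0\<close>.\<close>
    show "variation_le M \<Omega> \<A> w (\<lambda>x. rep (tv (v 0)) x + G 0 x)"
      unfolding variation_le_def
    proof (intro ballI allI)
      fix P :: "nat \<Rightarrow> 'o set" and N assume P: "P \<in> partitions \<Omega> \<A>"
      then have P': "range P \<subseteq> \<A>" "disjoint_family P"
        by (auto simp: partitions_def)
      from variation_leD[OF variation_le_tv[OF v[of 0]] P, of N] close[OF P']
      show "AE x in M. (\<Sum>n<N. \<bar>rep (w (P n)) x\<bar>) \<le> rep (tv (v 0)) x + G 0 x"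
      proof eventually_elim
        case (elim x)
        have "(\<Sum>n<N. \<bar>rep (w (P n)) x\<bar>)
            \<le> (\<Sum>n<N. \<bar>rep (v 0 (P n)) x\<bar> + \<bar>rep (v 0 (P n)) x - rep (w (P n)) x\<bar>)"
          by (intro sum_mono) simp
        also have "\<dots> \<le> rep (tv (v 0)) x + G 0 x"
          unfolding sum.distrib using elim by (intro add_mono) auto
        finally show ?case .
      qed
    qed
  qed (use rep_measurable[OF tv_closed[OF v]] in measurable)
  moreover have "w \<in> \<A> \<rightarrow>\<^sub>E ae_classes M"
    using w_closed by (auto simp: w_def)
  ultimately have w: "w \<in> carrier V"
    unfolding carrier_V_iff by (intro conjI)
  have vw: "v k \<ominus>\<^bsub>V\<^esub> w \<in> carrier V" for k
    using v w by simp
  have "AE x in M. rep (tv (v k \<ominus>\<^bsub>V\<^esub> w)) x \<le> G k x" for k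
  proof (rule tv_le[OF vw])
    show "variation_le M \<Omega> \<A> (v k \<ominus>\<^bsub>V\<^esub> w) (G k)"
      unfolding variation_le_def
    proof (intro ballI allI)
      fix P :: "nat \<Rightarrow> 'o set" and N assume P: "P \<in> partitions \<Omega> \<A>"
      then have P': "range P \<subseteq> \<A>" "disjoint_family P"
        by (auto simp: partitions_def)
      have "AE x in M. \<forall>n. rep ((v k \<ominus>\<^bsub>V\<^esub> w) (P n)) x = rep (v k (P n)) x - rep (w (P n)) x"
        unfolding AE_all_countable using P by (intro allI rep_V_minus v w partitionD)
      with close[OF P'] show "AE x in M. (\<Sum>n<N. \<bar>rep ((v k \<ominus>\<^bsub>V\<^esub> w) (P n)) x\<bar>) \<le> G k x"
        by eventually_elim simp
    qed
  qed measurable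
  then have "AE x in M. \<forall>k. rep (tv (v k \<ominus>\<^bsub>V\<^esub> w)) x \<le> G k x"
    by (simp add: AE_all_countable)
  moreover have "AE x in M. \<forall>k. 0 \<le> rep (tv (v k \<ominus>\<^bsub>V\<^esub> w)) x"
    unfolding AE_all_countable by (intro allI V.rep_nrm_nonneg vw)
  ultimately have "AE x in M. (\<lambda>k. rep (tv (v k \<ominus>\<^bsub>V\<^esub> w)) x) \<longlonglongrightarrow> 0"
    using G_0
  proof eventually_elim
    case (elim x)
    then show ?case
      by (intro tendsto_sandwich[OF _ _ tendsto_const elim(3)]) auto
  qed
  with w show ?thesis by blast
qed

end

theorem lemma3p5:
  fixes M :: "'a measure" and \<Omega> :: "'o set" and \<A> :: "'o set set"
  assumes "prob_space M" and "sigma_algebra \<Omega> \<A>"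
  shows "complete_random_normed_module M (L0_measures M \<Omega> \<A>) (TV_norm M \<Omega> \<A>)"
proof -
  interpret prob_space M by fact
  interpret sigma_algebra \<Omega> \<A> by fact
  interpret L0_measure_space M \<Omega> \<A> ..
  interpret V: random_normed_module M "L0_measures M \<Omega> \<A>" "TV_norm M \<Omega> \<A>"
    by (rule random_normed_module_V)
  show ?thesis
    by (intro complete_random_normed_module.intro complete_random_normed_module_axioms.intro
      V.random_normed_module_axioms V.Metric_space_rn_dist V.mcomplete_rn_dist summable_increments_converge)
qed

end
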